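(* Let $\mathfrak g$ be a simple Lie algebra over $\Bbbk$ and let $\vartheta=\vartheta(p_0,\dots,p_l)$ be an inner periodic automorphism of $\mathfrak g$ with Kac labels $(p_0,\dots,p_l)$ such that $p_0>0$. Let $\mathfrak p$ and $\mathfrak n^-$ be the subalgebras of $\mathfrak g$ determined by $p_1,\dots,p_l$, i.e., for the $\mathbb Z$-grading $\mathfrak g=\bigoplus_{j\in\mathbb Z}\mathfrak g(j)$ with $\mathfrak t\subset\mathfrak g(0)$ and $\mathfrak g^{\alpha_i}\subset\mathfrak g(p_i)$ ($i=1,\dots,l$), let $\mathfrak p=\bigoplus_{j\ge0}\mathfrak g(j)$ and $\mathfrak n^-=\bigoplus_{j<0}\mathfrak g(j)$. Then there is an isomorphism of Lie algebras $\mathfrak g_{(0)}\simeq\mathfrak p\ltimes(\mathfrak n^-)^{\sf ab}$.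
   Context: $\Bbbk$ is an algebraically closed field of characteristic $0$. Kac labels of inner periodic automorphisms. Let $\mathfrak g$ be simple, $l=\operatorname{rk}\mathfrak g$, $\mathfrak t$ a Cartan subalgebra, $\Delta$ the root system, $\Pi=\{\alpha_1,\dots,\alpha_l\}$ a set of simple roots, $\mathfrak g^\gamma$ the root space of $\gamma\in\Delta$, $\delta=\sum_{i=1}^l n_i\alpha_i$ the highest root, $\alpha_0=-\delta$, $n_0=1$. Write $[\gamma:\alpha_i]$ for the coefficient of $\alpha_i$ in $\gamma$. Let $\boldsymbol p=(p_0,\dots,p_l)\ne(0,\dots,0)$ be nonnegative integers with $\gcd(p_0,\dots,p_l)=1$, and put $m=\sum_{i=0}^l n_ip_i$. The automorphism $\vartheta(\boldsymbol p)$, of order $m$, is the inner automorphism acting trivially on $\mathfrak t$ and as multiplication by $\zeta^{d(\gamma)}$ on $\mathfrak g^\gamma$, where $d(\gamma)=\sum_{i=1}^l[\gamma:\alpha_i]p_i$ and $\zeta$ is a fixed primitive $m$-th root of unity; every inner automorphism of finite order is conjugate to one of this form. Periodic contraction. Let $\vartheta$ be an automorphism of $\mathfrak g$ of order $m$, and let $\mathfrak g=\bigoplus_{i=0}^{m-1}\mathfrak g_i$, where $\mathfrak g_i$ is the $\zeta^i$-eigenspace of $\vartheta$. The $\vartheta$-contraction $\mathfrak g_{(0)}$ is the vector space $\mathfrak g$ with the Lie bracket $[\ ,\,]_{(0)}$ defined for $x\in\mathfrak g_i$, $y\in\mathfrak g_j$ ($0\le i,j\le m-1$) by $[x,y]_{(0)}=[x,y]$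 if $i+j\le m-1$ and $[x,y]_{(0)}=0$ if $i+j>m-1$. The Lie algebra $\mathfrak p\ltimes(\mathfrak n^-)^{\sf ab}$ is the semi-direct product in which $\mathfrak n^-$ is identified, as a vector space, with the $\mathfrak p$-module $\mathfrak g/\mathfrak p$ and is an abelian ideal. So on the vector space $\mathfrak g=\mathfrak p\oplus\mathfrak n^-$ the new bracket coincides with $[\ ,\,]$ on $\mathfrak p$, vanishes on $\mathfrak n^-\times\mathfrak n^-$, and for $x\in\mathfrak p$, $y\in\mathfrak n^-$ it is the projection of $[x,y]$ to $\mathfrak n^-$ along $\mathfrak p$. *)

theory Defs
  imports Complex_Main "HOL-Computational_Algebra.Polynomial"
begin

section \<open>Lie algebras\<close>

locale lie_algebra = vector_space scale
  for scale :: "'k::field \<Rightarrow> 'v::ab_group_add \<Rightarrow> 'v" (infixr \<open>*s\<close> 75) +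
  fixes bracket :: "'v \<Rightarrow> 'v \<Rightarrow> 'v"
  assumes bracket_add_left: "bracket (x + y) z = bracket x z + bracket y z"
    and bracket_add_right: "bracket x (y + z) = bracket x y + bracket x z"
    and bracket_scale_left: "bracket (c *s x) y = c *s bracket x y"
    and bracket_scale_right: "bracket x (c *s y) = c *s bracket x y"
    and bracket_self: "bracket x x = 0"
    and jacobi: "bracket x (bracket y z) + bracket y (bracket z x) + bracket z (bracket x y) = 0"

definition lie_isomorphic ::
  "('k::field \<Rightarrow> 'v::ab_group_add \<Rightarrow> 'v) \<Rightarrow> ('v \<Rightarrow> 'v \<Rightarrow> 'v) \<Rightarrow>
   ('k \<Rightarrow> 'w::ab_group_add \<Rightarrow> 'w) \<Rightarrow> ('w \<Rightarrow> 'w \<Rightarrow> 'w) \<Rightarrow> bool" where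
  "lie_isomorphic s1 b1 s2 b2 \<longleftrightarrow>
     lie_algebra s1 b1 \<and> lie_algebra s2 b2 \<and>
     (\<exists>f. Vector_Spaces.linear s1 s2 f \<and> bij f \<and> (\<forall>x y. f (b1 x y) = b2 (f x) (f y)))"

definition is_decomposition ::
  "'i set \<Rightarrow> ('i \<Rightarrow> 'v::ab_group_add set) \<Rightarrow> 'v \<Rightarrow> ('i \<Rightarrow> 'v) \<Rightarrow> bool" where
  "is_decomposition I V x f \<longleftrightarrow>
     (\<forall>i\<in>I. f i \<in> V i) \<and> (\<forall>i. i \<notin> I \<longrightarrow> f i = 0) \<and>
     finite {i. f i \<noteq> 0} \<and> x = (\<Sum>i | f i \<noteq> 0. f i)"

text \<open>The component of \<open>x\<close> in \<open>V i\<close>; meaningful when the whole space is the direct sum of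
  the \<open>V i\<close> for \<open>i \<in> I\<close>.\<close>

definition component ::
  "'i set \<Rightarrow> ('i \<Rightarrow> 'v::ab_group_add set) \<Rightarrow> 'v \<Rightarrow> 'i \<Rightarrow> 'v" where
  "component I V x = (THE f. is_decomposition I V x f)"

text \<open>The projection to \<open>U\<close> along \<open>W\<close>; meaningful when the whole space is the direct sum of
  \<open>U\<close> and \<open>W\<close>.\<close>

definition proj_along :: "'v::ab_group_add set \<Rightarrow> 'v set \<Rightarrow> 'v \<Rightarrow> 'v" where
  "proj_along U W x = (THE u. u \<in> U \<and> x - u \<in> W)"

context lie_algebra
begin

definition ideal :: "'v set \<Rightarrow> bool" where
  "ideal I \<longleftrightarrow> subspace I \<and> (\<forall>x. \<forall>y\<in>I. bracket x y \<in> I)"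

definition subalgebra :: "'v set \<Rightarrow> bool" where
  "subalgebra U \<longleftrightarrow> subspace U \<and> (\<forall>x\<in>U. \<forall>y\<in>U. bracket x y \<in> U)"

definition abelian :: "'v set \<Rightarrow> bool" where
  "abelian U \<longleftrightarrow> (\<forall>x\<in>U. \<forall>y\<in>U. bracket x y = 0)"

definition ad_diagonalizable :: "'v \<Rightarrow> bool" where
  "ad_diagonalizable h \<longleftrightarrow> span {x. \<exists>c. bracket h x = c *s x} = UNIV"

text \<open>The usual definition for semisimple Lie algebras over an algebraically closed field of
  characteristic 0 (e.g. Helgason, Chapter III): a maximal abelian subalgebra all of whose
  elements are ad-semisimple.\<close>

definition cartan_subalgebra :: "'v set \<Rightarrow> bool" where
  "cartan_subalgebra t \<longleftrightarrow>
     subalgebra t \<and> abelian t \<and>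
     (\<forall>u. subalgebra u \<and> abelian u \<and> t \<subseteq> u \<longrightarrow> u = t) \<and>
     (\<forall>h\<in>t. ad_diagonalizable h)"


section \<open>Roots\<close>

text \<open>A linear functional on the subspace \<open>t\<close> is represented by a function on the whole space
  that is linear on \<open>t\<close> and 0 outside \<open>t\<close>, so that equality of functionals is equality of
  functions and linear combinations are pointwise.\<close>

definition dual_space :: "'v set \<Rightarrow> ('v \<Rightarrow> 'k) set" where
  "dual_space t = {f. (\<forall>x\<in>t. \<forall>y\<in>t. f (x + y) = f x + f y) \<and>
                      (\<forall>c. \<forall>x\<in>t. f (c *s x) = c * f x) \<and> (\<forall>x. x \<notin> t \<longrightarrow> f x = 0)}"

definition root_space :: "'v set \<Rightarrow> ('v \<Rightarrow> 'k) \<Rightarrow> 'v set" where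
  "root_space t \<gamma> = {x. \<forall>h\<in>t. bracket h x = \<gamma> h *s x}"

definition roots :: "'v set \<Rightarrow> ('v \<Rightarrow> 'k) set" where
  "roots t = {\<gamma> \<in> dual_space t. \<gamma> \<noteq> (\<lambda>_. 0) \<and> root_space t \<gamma> \<noteq> {0}}"

end

definition lin_comb :: "(nat \<Rightarrow> 'v \<Rightarrow> 'k::field) \<Rightarrow> nat \<Rightarrow> (nat \<Rightarrow> 'k) \<Rightarrow> 'v \<Rightarrow> 'k" where
  "lin_comb \<alpha> l c = (\<lambda>h. \<Sum>i=1..l. c i * \<alpha> i h)"

text \<open>\<open>root_coeff \<alpha> l \<gamma> i\<close> is $[\gamma:\alpha_i]$.\<close>

definition root_coeff :: "(nat \<Rightarrow> 'v \<Rightarrow> 'k::field) \<Rightarrow> nat \<Rightarrow> ('v \<Rightarrow> 'k) \<Rightarrow> nat \<Rightarrow> int" where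
  "root_coeff \<alpha> l \<gamma> =
     (THE c. (\<forall>i. i \<notin> {1..l} \<longrightarrow> c i = 0) \<and> \<gamma> = lin_comb \<alpha> l (\<lambda>i. of_int (c i)))"

context lie_algebra
begin

definition simple_roots :: "'v set \<Rightarrow> (nat \<Rightarrow> 'v \<Rightarrow> 'k) \<Rightarrow> nat \<Rightarrow> bool" where
  "simple_roots t \<alpha> l \<longleftrightarrow>
     (\<forall>i\<in>{1..l}. \<alpha> i \<in> roots t) \<and>
     (\<forall>c. lin_comb \<alpha> l c = (\<lambda>_. 0) \<longrightarrow> (\<forall>i\<in>{1..l}. c i = 0)) \<and>
     (\<forall>\<gamma>\<in>roots t. \<exists>c::nat \<Rightarrow> int. \<gamma> = lin_comb \<alpha> l (\<lambda>i. of_int (c i)) \<and>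
        ((\<forall>i\<in>{1..l}. c i \<ge> 0) \<or> (\<forall>i\<in>{1..l}. c i \<le> 0)))"

definition highest_root :: "'v set \<Rightarrow> (nat \<Rightarrow> 'v \<Rightarrow> 'k) \<Rightarrow> nat \<Rightarrow> ('v \<Rightarrow> 'k) \<Rightarrow> bool" where
  "highest_root t \<alpha> l \<delta> \<longleftrightarrow>
     \<delta> \<in> roots t \<and> (\<forall>\<gamma>\<in>roots t. \<forall>i\<in>{1..l}. root_coeff \<alpha> l \<gamma> i \<le> root_coeff \<alpha> l \<delta> i)"

end


section \<open>Kac labels\<close>

definition kac_labels :: "nat \<Rightarrow> (nat \<Rightarrow> nat) \<Rightarrow> bool" where
  "kac_labels l p \<longleftrightarrow> (\<exists>i\<in>{0..l}. p i \<noteq> 0) \<and> Gcd (p ` {0..l}) = 1"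

text \<open>\<open>n_0 = 1\<close> and \<open>n_i\<close> is the coefficient of the highest root \<open>\<delta>\<close> at \<open>\<alpha>_i\<close>, which is
  nonnegative.\<close>

definition highest_coeff :: "(nat \<Rightarrow> 'v \<Rightarrow> 'k::field) \<Rightarrow> nat \<Rightarrow> ('v \<Rightarrow> 'k) \<Rightarrow> nat \<Rightarrow> nat" where
  "highest_coeff \<alpha> l \<delta> i = (if i = 0 then 1 else nat (root_coeff \<alpha> l \<delta> i))"

definition kac_order ::
  "(nat \<Rightarrow> 'v \<Rightarrow> 'k::field) \<Rightarrow> nat \<Rightarrow> ('v \<Rightarrow> 'k) \<Rightarrow> (nat \<Rightarrow> nat) \<Rightarrow> nat" where
  "kac_order \<alpha> l \<delta> p = (\<Sum>i=0..l. highest_coeff \<alpha> l \<delta> i * p i)"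

definition kac_degree ::
  "(nat \<Rightarrow> 'v \<Rightarrow> 'k::field) \<Rightarrow> nat \<Rightarrow> (nat \<Rightarrow> nat) \<Rightarrow> ('v \<Rightarrow> 'k) \<Rightarrow> int" where
  "kac_degree \<alpha> l p \<gamma> = (\<Sum>i=1..l. root_coeff \<alpha> l \<gamma> i * int (p i))"

definition primitive_root_of_unity :: "nat \<Rightarrow> 'k::field \<Rightarrow> bool" where
  "primitive_root_of_unity m \<zeta> \<longleftrightarrow> m > 0 \<and> \<zeta> ^ m = 1 \<and> (\<forall>k\<in>{1..<m}. \<zeta> ^ k \<noteq> 1)"

context lie_algebra
begin

definition ad_nilpotent :: "'v \<Rightarrow> bool" where
  "ad_nilpotent x \<longleftrightarrow> (\<exists>n. \<forall>y. (bracket x ^^ n) y = 0)"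

text \<open>The exponential series of \<open>ad x\<close>, a finite sum for ad-nilpotent \<open>x\<close>.\<close>

definition exp_ad :: "'v \<Rightarrow> 'v \<Rightarrow> 'v" where
  "exp_ad x y = (\<Sum>n | (bracket x ^^ n) y \<noteq> 0. (1 / of_nat (fact n)) *s (bracket x ^^ n) y)"

text \<open>The group generated by the automorphisms \<open>exp_ad x\<close> for ad-nilpotent \<open>x\<close>; closure under
  inverses is automatic, since \<open>exp_ad (- x)\<close> is the inverse of \<open>exp_ad x\<close>.\<close>

inductive inner_automorphism :: "('v \<Rightarrow> 'v) \<Rightarrow> bool" where
  inner_id: "inner_automorphism id"
| inner_exp: "ad_nilpotent x \<Longrightarrow> inner_automorphism \<phi> \<Longrightarrow> inner_automorphism (exp_ad x \<circ> \<phi>)"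

definition kac_automorphism ::
  "'v set \<Rightarrow> (nat \<Rightarrow> 'v \<Rightarrow> 'k) \<Rightarrow> nat \<Rightarrow> (nat \<Rightarrow> nat) \<Rightarrow> 'k \<Rightarrow> ('v \<Rightarrow> 'v) \<Rightarrow> bool" where
  "kac_automorphism t \<alpha> l p \<zeta> \<theta> \<longleftrightarrow>
     inner_automorphism \<theta> \<and> (\<forall>h\<in>t. \<theta> h = h) \<and>
     (\<forall>\<gamma>\<in>roots t. \<forall>x\<in>root_space t \<gamma>. \<theta> x = (\<zeta> powi kac_degree \<alpha> l p \<gamma>) *s x)"


section \<open>Periodic contractions and semi-direct products\<close>

definition eigenspace :: "('v \<Rightarrow> 'v) \<Rightarrow> 'k \<Rightarrow> 'v set" where
  "eigenspace \<theta> c = {x. \<theta> x = c *s x}"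

definition eigen_component :: "('v \<Rightarrow> 'v) \<Rightarrow> nat \<Rightarrow> 'k \<Rightarrow> 'v \<Rightarrow> nat \<Rightarrow> 'v" where
  "eigen_component \<theta> m \<zeta> = component {0..<m} (\<lambda>i. eigenspace \<theta> (\<zeta> ^ i))"

text \<open>The bilinear extension of the contracted bracket from eigenvectors to the whole space,
  for an automorphism \<open>\<theta>\<close> of order \<open>m\<close> and a primitive \<open>m\<close>-th root of unity \<open>\<zeta>\<close>.\<close>

definition contracted_bracket :: "('v \<Rightarrow> 'v) \<Rightarrow> nat \<Rightarrow> 'k \<Rightarrow> 'v \<Rightarrow> 'v \<Rightarrow> 'v" where
  "contracted_bracket \<theta> m \<zeta> x y =
     (\<Sum>i\<in>{0..<m}. \<Sum>j\<in>{0..<m}.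
        if i + j \<le> m - 1
        then bracket (eigen_component \<theta> m \<zeta> x i) (eigen_component \<theta> m \<zeta> y j) else 0)"

definition lie_grading :: "(int \<Rightarrow> 'v set) \<Rightarrow> bool" where
  "lie_grading G \<longleftrightarrow>
     (\<forall>j. subspace (G j)) \<and>
     (\<forall>x. \<exists>!f. is_decomposition UNIV G x f) \<and>
     (\<forall>i j. \<forall>x\<in>G i. \<forall>y\<in>G j. bracket x y \<in> G (i + j))"

definition nonneg_part :: "(int \<Rightarrow> 'v set) \<Rightarrow> 'v set" where
  "nonneg_part G = span (\<Union>j\<in>{0..}. G j)"

definition neg_part :: "(int \<Rightarrow> 'v set) \<Rightarrow> 'v set" where
  "neg_part G = span (\<Union>j\<in>{..<0}. G j)"

text \<open>The bracket of the semi-direct product of \<open>P\<close> and the abelian ideal \<open>N\<close>, where \<open>N\<close> is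
  identified with the quotient by \<open>P\<close>, realised on the direct sum of \<open>P\<close> and \<open>N\<close>.\<close>

definition semidirect_bracket :: "'v set \<Rightarrow> 'v set \<Rightarrow> 'v \<Rightarrow> 'v \<Rightarrow> 'v" where
  "semidirect_bracket P N x y =
     bracket (proj_along P N x) (proj_along P N y) +
     proj_along N P (bracket (proj_along P N x) (proj_along N P y)) +
     proj_along N P (bracket (proj_along N P x) (proj_along P N y))"

end

locale simple_lie_algebra = lie_algebra +
  assumes finite_dim: "\<exists>B. finite B \<and> span B = UNIV"
    and nonabelian: "\<not> abelian UNIV"
    and ideal_trivial: "ideal I \<Longrightarrow> I = {0} \<or> I = UNIV"

end

theory Submission
  imports Defs
begin

text \<open>Writing \<open>d(\<gamma>)\<close> for the Kac degree, \<open>p\<^sub>0 > 0\<close> gives \<open>\<bar>d(\<gamma>)\<bar> < m\<close> for all roots. Hence the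
  \<open>\<zeta>\<^sup>i\<close>-eigenspace of \<open>\<theta>\<close> is \<open>G i \<oplus> G (i - m)\<close>, and comparing degrees shows that the two brackets
  coincide, so that the identity is an isomorphism. What has to be proved is that
  \<open>root_space t \<gamma> \<subseteq> G (d(\<gamma>))\<close>, although only the simple root spaces are assumed to be homogeneous:
  the derivation multiplying \<open>G j\<close> by \<open>j\<close> is inner because the Killing form is nondegenerate, and it is
  \<open>ad h\<close> for some \<open>h\<close> in the centralizer \<open>t\<close> of \<open>t\<close>, with \<open>\<alpha>\<^sub>i(h) = p\<^sub>i\<close>.\<close>

section \<open>Eigenvectors and direct sums\<close>

text \<open>Going up from simple root vectors by brackets would reach only the positive part: no
  degree is assumed for the root spaces of the negatives of the simple roots. An element
  \<open>h\<close> of \<open>t\<close> that induces the grading treats all roots alike, because a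
  root is linear on \<open>t\<close> and its value at \<open>h\<close> is determined by those of the
  simple roots. The price is the nondegeneracy of the Killing form. By simplicity it suffices that
  the form is not zero, and this is seen on \<open>t\<close> by computing traces in a basis of
  vectors from \<open>t\<close> and the root spaces, on which \<open>t\<close> acts diagonally. The
  same form shows that the negative of a root is a root, which turns an upper bound on degrees into
  a two-sided one. As the isomorphism is the identity, the Jacobi identity is verified for the
  semi-direct product alone and then holds for the contraction.\<close>

context vector_space
begin

text \<open>Subtracting \<open>c a\<close> from \<open>f\<close> kills the summand at
  \<open>a\<close> and multiplies every other one by the nonzero scalar \<open>c i - c a\<close>, so
  the induction hypothesis applies to the rest. The summands may be zero, which suits components of
  a decomposition.\<close>

lemma eigenvectors_sum_eq_0:
  assumes "Vector_Spaces.linear scale scale f"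
    and "finite F" "inj_on c F" "\<And>i. i \<in> F \<Longrightarrow> f (w i) = scale (c i) (w i)"
    and "(\<Sum>i\<in>F. w i) = 0" "i \<in> F"
  shows "w i = 0"
proof -
  interpret f: Vector_Spaces.linear scale scale f by fact
  have "\<forall>i\<in>F. w i = 0"
    using assms(2-5)
  proof (induction F arbitrary: w rule: finite_induct)
    case empty
    then show ?case by simp
  next
    case (insert a F)
    let ?w = "\<lambda>i. scale (c i - c a) (w i)"
    have "0 = f (\<Sum>i\<in>insert a F. w i) - scale (c a) (\<Sum>i\<in>insert a F. w i)"
      by (simp only: insert.prems(3) f.zero scale_zero_right diff_0_right)
    also have "\<dots> = (\<Sum>i\<in>insert a F. f (w i) - scale (c a) (w i))"
      by (simp only: f.sum scale_sum_right sum_subtractf)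
    also have "\<dots> = (\<Sum>i\<in>insert a F. ?w i)"
      by (rule sum.cong) (simp_all add: insert.prems(2) scale_left_diff_distrib)
    also have "\<dots> = (\<Sum>i\<in>F. ?w i)"
      using insert.hyps by simp
    finally have sum0: "(\<Sum>i\<in>F. ?w i) = 0" by simp
    have "\<forall>i\<in>F. ?w i = 0"
    proof (rule insert.IH[OF _ _ sum0])
      show "inj_on c F" using insert.prems(1) by simp
      show "f (?w i) = scale (c i) (?w i)" if "i \<in> F" for i
        using insert.prems(2)[of i] that by (simp add: f.scale mult.commute)
    qed
    moreover have "c i \<noteq> c a" if "i \<in> F" for i
      using inj_onD[OF insert.prems(1), of i a] insert.hyps that by auto
    ultimately have "\<forall>i\<in>F. w i = 0" by simp
    then show ?case using insert.prems(3) insert.hyps by simp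
  qed
  then show ?thesis using assms(6) by blast
qed

lemma linear_eqI_on_span:
  assumes "Vector_Spaces.linear scale scale f" "Vector_Spaces.linear scale scale g"
    and "\<And>b. b \<in> B \<Longrightarrow> f b = g b" "span B = UNIV"
  shows "f x = g x"
proof -
  interpret f: Vector_Spaces.linear scale scale f by fact
  interpret g: Vector_Spaces.linear scale scale g by fact
  have "x \<in> span B" using assms(4) by simp
  then show ?thesis
    by (induction rule: span_induct)
      (auto simp: assms(3) subspace_def f.add g.add f.scale g.scale f.zero g.zero)
qed

lemma bilinear_eqI_on_span:
  assumes "\<And>y. Vector_Spaces.linear scale scale (\<lambda>x. f x y)" "\<And>x. Vector_Spaces.linear scale scale (f x)"
    and "\<And>y. Vector_Spaces.linear scale scale (\<lambda>x. g x y)" "\<And>x. Vector_Spaces.linear scale scale (g x)"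
    and "\<And>a b. a \<in> B \<Longrightarrow> b \<in> B \<Longrightarrow> f a b = g a b" "span B = UNIV"
  shows "f x y = g x y"
proof -
  have "f a y = g a y" if "a \<in> B" for a
    using linear_eqI_on_span[OF assms(2,4) assms(5)[OF that] assms(6)] .
  then show ?thesis
    by (rule linear_eqI_on_span[OF assms(1,3) _ assms(6)])
qed

lemma is_decomposition_sum:
  assumes "is_decomposition I V x f" "finite J" "{i. f i \<noteq> 0} \<subseteq> J"
  shows "x = (\<Sum>i\<in>J. f i)"
  using assms by (auto simp: is_decomposition_def intro: sum.mono_neutral_left)

lemma is_decompositionI:
  assumes "\<And>i. i \<in> I \<Longrightarrow> f i \<in> V i" "\<And>i. i \<notin> I \<Longrightarrow> f i = 0"
    and "finite J" "{i. f i \<noteq> 0} \<subseteq> J" "x = (\<Sum>i\<in>J. f i)"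
  shows "is_decomposition I V x f"
  using assms finite_subset[OF assms(4,3)]
  by (auto simp: is_decomposition_def intro: sum.mono_neutral_right)

lemma is_decomposition_add:
  assumes "\<And>i. i \<in> I \<Longrightarrow> subspace (V i)" "is_decomposition I V x f" "is_decomposition I V y g"
  shows "is_decomposition I V (x + y) (\<lambda>i. f i + g i)"
proof (rule is_decompositionI)
  let ?J = "{i. f i \<noteq> 0} \<union> {i. g i \<noteq> 0}"
  show fin: "finite ?J" using assms(2,3) by (auto simp: is_decomposition_def)
  show "x + y = (\<Sum>i\<in>?J. f i + g i)"
    using is_decomposition_sum[OF assms(2) fin] is_decomposition_sum[OF assms(3) fin]
    by (simp add: sum.distrib)
qed (use assms in \<open>auto simp: is_decomposition_def intro: subspace_add\<close>)

lemma is_decomposition_scale: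
  assumes "\<And>i. i \<in> I \<Longrightarrow> subspace (V i)" "is_decomposition I V x f"
  shows "is_decomposition I V (scale c x) (\<lambda>i. scale c (f i))"
proof (rule is_decompositionI)
  let ?J = "{i. f i \<noteq> 0}"
  show "finite ?J" using assms(2) by (auto simp: is_decomposition_def)
  show "scale c x = (\<Sum>i\<in>?J. scale c (f i))"
    using assms(2) by (simp add: is_decomposition_def scale_sum_right)
qed (use assms in \<open>auto simp: is_decomposition_def intro: subspace_scale\<close>)

lemma is_decomposition_single:
  assumes "\<And>i. i \<in> I \<Longrightarrow> subspace (V i)" "i \<in> I" "x \<in> V i"
  shows "is_decomposition I V x (\<lambda>j. if j = i then x else 0)"
  by (rule is_decompositionI[where J = "{i}"]) (use assms in \<open>auto intro: subspace_0\<close>)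

end

text \<open>Direct sums occur with two index sets: all integers for the grading, and
  \<open>{0..<m}\<close> for the eigenspaces of \<open>\<theta>\<close>.\<close>

locale direct_decomposition = vector_space scale
  for scale :: "'k::field \<Rightarrow> 'v::ab_group_add \<Rightarrow> 'v" +
  fixes I :: "'i set" and V :: "'i \<Rightarrow> 'v set"
  assumes subspace_summand: "i \<in> I \<Longrightarrow> subspace (V i)"
    and unique_decomposition: "\<exists>!f. is_decomposition I V x f"
begin

lemma is_decomposition_component: "is_decomposition I V x (component I V x)"
  unfolding component_def by (rule theI'[OF unique_decomposition])

lemma component_eqI: "is_decomposition I V x f \<Longrightarrow> component I V x = f"
  using is_decomposition_component unique_decomposition by blast

lemma component_mem: "i \<in> I \<Longrightarrow> component I V x i \<in> V i"
  using is_decomposition_component by (simp add: is_decomposition_def)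

lemma finite_component: "finite {i. component I V x i \<noteq> 0}"
  using is_decomposition_component by (simp add: is_decomposition_def)

lemma linear_component: "Vector_Spaces.linear scale scale (\<lambda>x. component I V x i)"
proof -
  have "component I V (x + y) = (\<lambda>i. component I V x i + component I V y i)" for x y
    by (intro component_eqI is_decomposition_add is_decomposition_component subspace_summand)
  moreover have "component I V (scale c x) = (\<lambda>i. scale c (component I V x i))" for c x
    by (intro component_eqI is_decomposition_scale is_decomposition_component subspace_summand)
  ultimately show ?thesis
    by (simp add: Vector_Spaces.linear_iff vector_space_axioms)
qed

lemma component_summand:
  "i \<in> I \<Longrightarrow> x \<in> V i \<Longrightarrow> component I V x = (\<lambda>j. if j = i then x else 0)"
  by (intro component_eqI is_decomposition_single subspace_summand)

lemma sum_component:
  "finite J \<Longrightarrow> {i. component I V x i \<noteq> 0} \<subseteq> J \<Longrightarrow> (\<Sum>i\<in>J. component I V x i) = x"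
  using is_decomposition_sum[OF is_decomposition_component] by metis

end

section \<open>Semi-direct products\<close>

text \<open>Only the projection to the first space is studied; \<open>complements_swap\<close> makes
  the results available for the second.\<close>

locale complements = vector_space scale
  for scale :: "'k::field \<Rightarrow> 'v::ab_group_add \<Rightarrow> 'v" +
  fixes P N :: "'v set"
  assumes subspaces: "subspace P" "subspace N"
    and Int_eq_0: "x \<in> P \<Longrightarrow> x \<in> N \<Longrightarrow> x = 0"
    and sum_eq_UNIV: "\<exists>u\<in>P. x - u \<in> N"
begin

lemma proj_along_unique:
  assumes "u \<in> P" "x - u \<in> N"
  shows "proj_along P N x = u"
  unfolding proj_along_def
proof (rule the_equality)
  fix v assume v: "v \<in> P \<and> x - v \<in> N"
  have "(x - v) - (x - u) \<in> N" using v assms subspaces(2) subspace_diff by blast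
  moreover have "u - v \<in> P" using v assms subspaces(1) subspace_diff by blast
  ultimately have "u - v = 0" by (intro Int_eq_0) simp_all
  then show "v = u" by simp
qed (use assms in auto)

lemma proj_along: "proj_along P N x \<in> P" "x - proj_along P N x \<in> N"
  using sum_eq_UNIV[of x] proj_along_unique by auto

lemma linear_proj_along: "Vector_Spaces.linear scale scale (proj_along P N)"
proof -
  have "proj_along P N (x + y) = proj_along P N x + proj_along P N y" for x y
  proof (rule proj_along_unique)
    have "(x - proj_along P N x) + (y - proj_along P N y) \<in> N"
      using proj_along subspaces subspace_add by blast
    then show "x + y - (proj_along P N x + proj_along P N y) \<in> N" by (simp add: algebra_simps)
  qed (use proj_along subspaces subspace_add in blast)
  moreover have "proj_along P N (scale c x) = scale c (proj_along P N x)" for c x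
  proof (rule proj_along_unique)
    have "scale c (x - proj_along P N x) \<in> N"
      using proj_along subspaces subspace_scale by blast
    then show "scale c x - scale c (proj_along P N x) \<in> N" by (simp add: scale_right_diff_distrib)
  qed (use proj_along subspaces subspace_scale in blast)
  ultimately show ?thesis
    by (simp add: Vector_Spaces.linear_iff vector_space_axioms)
qed

lemma complements_swap: "complements scale N P"
proof
  fix x show "\<exists>u\<in>N. x - u \<in> P"
    using proj_along[of x] by (intro bexI[of _ "x - proj_along P N x"]) auto
qed (use subspaces Int_eq_0 in auto)

lemma proj_along_of_mem: "x \<in> P \<Longrightarrow> proj_along P N x = x" "x \<in> N \<Longrightarrow> proj_along P N x = 0"
  by (auto intro!: proj_along_unique simp: subspace_0 subspaces)

end

context lie_algebra
begin

lemma linear_bracket: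
  "Vector_Spaces.linear scale scale (bracket x)" "Vector_Spaces.linear scale scale (\<lambda>x. bracket x y)"
  by (simp_all add: Vector_Spaces.linear_iff vector_space_axioms bracket_add_left bracket_add_right
      bracket_scale_left bracket_scale_right)

lemma bracket_0 [simp]: "bracket x 0 = 0" "bracket 0 x = 0"
  using bracket_scale_left[of 0 0 x] bracket_scale_right[of x 0 0] by auto

lemma bracket_skew: "bracket y x = - bracket x y"
proof -
  have "bracket y x + bracket x y = 0"
    using bracket_self[of "x + y"]
    by (simp only: bracket_add_left bracket_add_right bracket_self[of x] bracket_self[of y]
        add_0_left add_0_right)
  then show ?thesis by (simp add: eq_neg_iff_add_eq_0)
qed

lemma bracket_minus: "bracket x (- y) = - bracket x y" "bracket (- x) y = - bracket x y"
  using bracket_scale_right[of x "-1" y] bracket_scale_left[of "-1" x y] by simp_all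

lemma bracket_derivation: "bracket x (bracket y z) = bracket (bracket x y) z + bracket y (bracket x z)"
proof -
  have "bracket y (bracket z x) = - bracket y (bracket x z)"
    by (simp add: bracket_skew[of z x] bracket_minus)
  moreover have "bracket z (bracket x y) = - bracket (bracket x y) z"
    by (rule bracket_skew)
  ultimately show ?thesis using jacobi[of x y z] by (simp add: algebra_simps)
qed

lemma bracket_diff: "bracket x (y - z) = bracket x y - bracket x z"
  "bracket (x - y) z = bracket x z - bracket y z"
  using bracket_add_right[of x y "- z"] bracket_add_left[of x "- y" z] by (simp_all add: bracket_minus)

lemma bracket_sum: "bracket x (\<Sum>i\<in>J. f i) = (\<Sum>i\<in>J. bracket x (f i))"
  "bracket (\<Sum>i\<in>J. f i) x = (\<Sum>i\<in>J. bracket (f i) x)"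
proof -
  interpret l: Vector_Spaces.linear scale scale "bracket x" by (rule linear_bracket)
  interpret r: Vector_Spaces.linear scale scale "\<lambda>y. bracket y x" by (rule linear_bracket)
  show "bracket x (\<Sum>i\<in>J. f i) = (\<Sum>i\<in>J. bracket x (f i))"
    "bracket (\<Sum>i\<in>J. f i) x = (\<Sum>i\<in>J. bracket (f i) x)"
    by (rule l.sum r.sum)+
qed

lemma linear_semidirect_bracket:
  assumes "complements scale P N"
  shows "Vector_Spaces.linear scale scale (semidirect_bracket P N x)"
    "Vector_Spaces.linear scale scale (\<lambda>x. semidirect_bracket P N x y)"
proof -
  interpret PN: complements scale P N by fact
  interpret NP: complements scale N P by (rule PN.complements_swap)
  interpret p: Vector_Spaces.linear scale scale "proj_along P N" by (rule PN.linear_proj_along)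
  interpret q: Vector_Spaces.linear scale scale "proj_along N P" by (rule NP.linear_proj_along)
  show "Vector_Spaces.linear scale scale (semidirect_bracket P N x)"
    "Vector_Spaces.linear scale scale (\<lambda>x. semidirect_bracket P N x y)"
    by (simp_all add: Vector_Spaces.linear_iff vector_space_axioms semidirect_bracket_def
      p.add p.scale q.add q.scale bracket_add_left bracket_add_right
      bracket_scale_left bracket_scale_right scale_right_distrib)
qed

text \<open>In the Jacobi sum, terms with two or three entries from \<open>N\<close> vanish. What
  survives is the Jacobi sum of the \<open>P\<close>-parts and the projection to \<open>N\<close> of
  the three Jacobi sums with exactly one entry from \<open>N\<close>; each is zero for the original
  bracket.\<close>

lemma lie_algebra_semidirect_bracket:
  assumes "complements scale P N" and "subalgebra P"
  shows "lie_algebra scale (semidirect_bracket P N)"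
proof -
  interpret PN: complements scale P N by fact
  interpret NP: complements scale N P by (rule PN.complements_swap)
  interpret p: Vector_Spaces.linear scale scale "proj_along P N" by (rule PN.linear_proj_along)
  interpret q: Vector_Spaces.linear scale scale "proj_along N P" by (rule NP.linear_proj_along)
  let ?p = "proj_along P N" and ?q = "proj_along N P"
  have brP: "bracket x y \<in> P" if "x \<in> P" "y \<in> P" for x y
    using assms(2) that by (auto simp: subalgebra_def)
  have split: "x = ?p x + ?q x" for x
    using NP.proj_along_unique[of "x - ?p x" x] PN.proj_along[of x] by simp
  have absorb: "?q (bracket (?p x) (?q u)) = ?q (bracket (?p x) u)" for x u
  proof -
    have "?q (bracket (?p x) u) = ?q (bracket (?p x) (?p u)) + ?q (bracket (?p x) (?q u))"
      by (simp flip: q.add bracket_add_right split)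
    then show ?thesis by (simp add: NP.proj_along_of_mem(2) brP PN.proj_along)
  qed
  have expand: "semidirect_bracket P N x (semidirect_bracket P N y z) =
      bracket (?p x) (bracket (?p y) (?p z)) +
      ?q (bracket (?p x) (bracket (?p y) (?q z)) + bracket (?p x) (bracket (?q y) (?p z)) +
          bracket (?q x) (bracket (?p y) (?p z)))" for x y z
  proof -
    have "?p (semidirect_bracket P N y z) = bracket (?p y) (?p z)"
      by (simp add: semidirect_bracket_def p.add PN.proj_along_of_mem NP.proj_along PN.proj_along brP)
    moreover have "?q (semidirect_bracket P N y z)
        = ?q (bracket (?p y) (?q z)) + ?q (bracket (?q y) (?p z))"
      by (simp add: semidirect_bracket_def q.add NP.proj_along_of_mem NP.proj_along PN.proj_along brP)
    ultimately show ?thesis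
      by (simp add: semidirect_bracket_def[of P N x] bracket_add_right q.add
          absorb[of x "bracket (?p y) (?q z)"] absorb[of x "bracket (?q y) (?p z)"])
  qed
  show ?thesis
  proof
    fix x y z
    show "semidirect_bracket P N (x + y) z = semidirect_bracket P N x z + semidirect_bracket P N y z"
      "semidirect_bracket P N x (y + z) = semidirect_bracket P N x y + semidirect_bracket P N x z"
      using linear_semidirect_bracket[OF assms(1)] by (auto simp: Vector_Spaces.linear_iff)
    show "semidirect_bracket P N (c *s x) y = c *s semidirect_bracket P N x y"
      "semidirect_bracket P N x (c *s y) = c *s semidirect_bracket P N x y" for c
      using linear_semidirect_bracket[OF assms(1)] by (auto simp: Vector_Spaces.linear_iff)
    show "semidirect_bracket P N x x = 0"
      by (simp add: semidirect_bracket_def bracket_self bracket_skew[of "?q x" "?p x"] q.neg)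
    let ?J = "\<lambda>a b c. bracket a (bracket b c) + bracket b (bracket c a) + bracket c (bracket a b)"
    have "semidirect_bracket P N x (semidirect_bracket P N y z) +
      semidirect_bracket P N y (semidirect_bracket P N z x) +
      semidirect_bracket P N z (semidirect_bracket P N x y) =
      ?J (?p x) (?p y) (?p z) +
      ?q (?J (?p x) (?p y) (?q z) + ?J (?p x) (?q y) (?p z) + ?J (?q x) (?p y) (?p z))"
      unfolding expand by (simp add: q.add ac_simps)
    then show "semidirect_bracket P N x (semidirect_bracket P N y z) +
      semidirect_bracket P N y (semidirect_bracket P N z x) +
      semidirect_bracket P N z (semidirect_bracket P N x y) = 0"
      by (simp only: jacobi q.zero add_0_right)
  qed
qed

end

section \<open>The Killing form\<close>

locale finite_dim_lie_algebra = lie_algebra scale bracket + finite_dimensional_vector_space scale Basis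
  for scale :: "'k::field \<Rightarrow> 'v::ab_group_add \<Rightarrow> 'v" (infixr \<open>*s\<close> 75)
    and bracket :: "'v \<Rightarrow> 'v \<Rightarrow> 'v" and Basis :: "'v set"
begin

lemma mem_span_Basis [simp]: "x \<in> span Basis"
  by (simp add: span_Basis)

lemma functional_eq_0I:
  fixes \<phi> :: "'v \<Rightarrow> 'k"
  assumes "\<And>b. b \<in> Basis \<Longrightarrow> \<phi> b = 0" "\<And>x y. \<phi> (x + y) = \<phi> x + \<phi> y" "\<And>c x. \<phi> (c *s x) = c * \<phi> x"
  shows "\<phi> y = 0"
proof -
  have "\<phi> 0 = 0" using assms(3)[of 0 0] by simp
  then have "subspace {y. \<phi> y = 0}" using assms by (simp add: subspace_def)
  then have "span Basis \<subseteq> {y. \<phi> y = 0}" using assms(1) by (intro span_minimal) auto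
  then show ?thesis using mem_span_Basis by blast
qed

definition trace :: "('v \<Rightarrow> 'v) \<Rightarrow> 'k" where
  "trace f = (\<Sum>b\<in>Basis. representation Basis (f b) b)"

lemma trace_commute:
  assumes "Vector_Spaces.linear scale scale f" "Vector_Spaces.linear scale scale g"
  shows "trace (\<lambda>x. f (g x)) = trace (\<lambda>x. g (f x))"
proof -
  have expand: "trace (\<lambda>x. f (g x)) =
      (\<Sum>b\<in>Basis. \<Sum>c\<in>Basis. representation Basis (g b) c * representation Basis (f c) b)"
    if f: "Vector_Spaces.linear scale scale f" for f g
  proof -
    interpret f: Vector_Spaces.linear scale scale f by fact
    have "representation Basis (f (g b)) b =
      (\<Sum>c\<in>Basis. representation Basis (g b) c * representation Basis (f c) b)" for b
    proof -
      have "f (g b) = f (\<Sum>c\<in>Basis. representation Basis (g b) c *s c)"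
        by (simp add: sum_representation_eq independent_Basis finite_Basis)
      then show ?thesis
        by (simp add: f.sum f.scale representation_sum representation_scale independent_Basis)
    qed
    then show ?thesis by (simp add: trace_def)
  qed
  show ?thesis
    unfolding expand[OF assms(1)] expand[OF assms(2)]
    by (subst sum.swap) (simp add: mult.commute)
qed

lemma trace_add: "trace (\<lambda>x. f x + g x) = trace f + trace g"
  by (simp add: trace_def representation_add independent_Basis sum.distrib)

lemma trace_diff: "trace (\<lambda>x. f x - g x) = trace f - trace g"
  by (simp add: trace_def representation_diff independent_Basis sum_subtractf)

lemma trace_scale: "trace (\<lambda>x. c *s f x) = c * trace f"
  by (simp add: trace_def representation_scale independent_Basis sum_distrib_left)

definition killing :: "'v \<Rightarrow> 'v \<Rightarrow> 'k" where
  "killing x y = trace (\<lambda>z. bracket x (bracket y z))"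

lemma killing_add: "killing (x + x') y = killing x y + killing x' y"
  "killing x (y + y') = killing x y + killing x y'"
  by (simp_all add: killing_def bracket_add_left bracket_add_right trace_add)

lemma killing_scale: "killing (c *s x) y = c * killing x y" "killing x (c *s y) = c * killing x y"
  by (simp_all add: killing_def bracket_scale_left bracket_scale_right trace_scale)

lemma killing_0 [simp]: "killing 0 y = 0" "killing x 0 = 0"
  using killing_scale(1)[of 0 0 y] killing_scale(2)[of x 0 0] by simp_all

lemma killing_minus: "killing (- x) y = - killing x y"
  using killing_scale(1)[of "-1" x y] by simp

lemma linear_bracket2: "Vector_Spaces.linear scale scale (\<lambda>z. bracket x (bracket y z))"
  by (simp add: Vector_Spaces.linear_iff vector_space_axioms bracket_add_right bracket_scale_right)

text \<open>Both sides start from the trace of \<open>ad x ad y ad z\<close>. They subtract the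
  traces of \<open>ad y ad x ad z\<close> and \<open>ad x ad z ad y\<close>, which are cyclic
  permutations of each other.\<close>

lemma killing_invariant: "killing (bracket x y) z = killing x (bracket y z)"
proof -
  have "bracket (bracket x y) (bracket z w) =
      bracket x (bracket y (bracket z w)) - bracket y (bracket x (bracket z w))" for w
    using bracket_derivation[of x y] by simp
  moreover have "bracket x (bracket (bracket y z) w) =
      bracket x (bracket y (bracket z w)) - bracket x (bracket z (bracket y w))" for w
    using bracket_derivation[of y z w]
    by (simp add: bracket_add_right)
  moreover have "trace (\<lambda>w. bracket y (bracket x (bracket z w))) =
      trace (\<lambda>w. bracket x (bracket z (bracket y w)))"
    by (rule trace_commute[OF linear_bracket(1) linear_bracket2])
  ultimately show ?thesis by (simp add: killing_def trace_diff)
qed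

lemma ideal_killing_radical: "ideal {x. \<forall>y. killing x y = 0}"
  unfolding ideal_def subspace_def
proof (intro conjI allI ballI)
  fix a x assume "x \<in> {x. \<forall>y. killing x y = 0}"
  then show "bracket a x \<in> {x. \<forall>y. killing x y = 0}"
    by (simp add: bracket_skew[of a x] killing_minus killing_invariant)
qed (auto simp: killing_add killing_scale)

lemma derivation_inner:
  assumes nondeg: "\<And>x. (\<And>y. killing x y = 0) \<Longrightarrow> x = 0"
    and D: "Vector_Spaces.linear scale scale D"
    and deriv: "\<And>x y. D (bracket x y) = bracket (D x) y + bracket x (D y)"
  shows "\<exists>h. \<forall>x. D x = bracket h x"
proof -
  interpret D: Vector_Spaces.linear scale scale D by fact
  \<comment> \<open>\<open>F x\<close> collects the values of \<open>killing x\<close> on the basis.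
    Its injectivity is nondegeneracy; its surjectivity says that every linear functional is
    represented by the form.\<close>
  define F where "F x = (\<Sum>b\<in>Basis. killing x b *s b)" for x
  have F: "Vector_Spaces.linear scale scale F"
    by (simp add: Vector_Spaces.linear_iff vector_space_axioms F_def killing_add killing_scale
        scale_left_distrib sum.distrib scale_sum_right)
  interpret F: Vector_Spaces.linear scale scale F by (rule F)
  have inj: "inj F"
    unfolding F.inj_iff_eq_0
  proof (intro allI impI)
    fix x assume "F x = 0"
    then have "killing x b = 0" if "b \<in> Basis" for b
      using independentD[OF independent_Basis finite_Basis subset_refl, of "killing x" b] that
      by (simp add: F_def)
    then have "killing x y = 0" for y
      by (rule functional_eq_0I) (simp_all add: killing_add killing_scale)
    then show "x = 0" by (rule nondeg)
  qed
  have surj: "surj F" by (rule linear_inj_imp_surj[OF F inj])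
  \<comment> \<open>The element \<open>h\<close> represents the functional that sends
    \<open>y\<close> to the trace of \<open>D\<close> composed with \<open>ad y\<close>. Then
    \<open>E\<close>, which is \<open>D\<close> minus \<open>ad h\<close>, is a derivation
    orthogonal to all inner ones under the trace form.\<close>
  obtain h where h: "F h = (\<Sum>b\<in>Basis. trace (\<lambda>z. D (bracket b z)) *s b)"
    using surjD[OF surj, of "\<Sum>b\<in>Basis. trace (\<lambda>z. D (bracket b z)) *s b"] by (auto dest: sym)
  define E where "E x = D x - bracket h x" for x
  have E: "Vector_Spaces.linear scale scale E"
    by (simp add: Vector_Spaces.linear_iff vector_space_axioms E_def D.add D.scale bracket_add_right
        bracket_scale_right scale_right_diff_distrib)
  interpret E: Vector_Spaces.linear scale scale E by (rule E)
  have trace_E: "trace (\<lambda>z. E (bracket y z)) = 0" for y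
  proof (rule functional_eq_0I[where \<phi> = "\<lambda>y. trace (\<lambda>z. E (bracket y z))"])
    have "(\<Sum>b\<in>Basis. (killing h b - trace (\<lambda>z. D (bracket b z))) *s b) = 0"
      using h by (simp add: F_def scale_left_diff_distrib sum_subtractf)
    then have "killing h b - trace (\<lambda>z. D (bracket b z)) = 0" if "b \<in> Basis" for b
      using that
      by (rule independentD[OF independent_Basis finite_Basis subset_refl])
    then show "trace (\<lambda>z. E (bracket b z)) = 0" if "b \<in> Basis" for b
      using that by (simp add: E_def trace_diff killing_def)
  qed (simp_all add: bracket_add_left bracket_scale_left E.add E.scale trace_add trace_scale)
  have E_deriv: "E (bracket x y) = bracket (E x) y + bracket x (E y)" for x y
    using bracket_derivation[of h x y]
    by (simp add: E_def deriv algebra_simps bracket_add_left bracket_add_right bracket_diff)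
  \<comment> \<open>\<open>ad (E a)\<close> is the commutator of \<open>E\<close> and
    \<open>ad a\<close>. By cyclicity of the trace, \<open>killing (E a) y\<close> equals the trace
    of \<open>E\<close> composed with \<open>ad (bracket a y)\<close>, which is 0 by
    \<open>trace_E\<close>.\<close>
  have "E a = 0" for a
  proof (rule nondeg)
    fix y
    have "bracket (E a) w = E (bracket a w) - bracket a (E w)" for w
      using E_deriv[of a w] by simp
    then have "killing (E a) y =
        trace (\<lambda>z. E (bracket a (bracket y z))) - trace (\<lambda>z. bracket a (E (bracket y z)))"
      by (simp add: killing_def trace_diff)
    also have "trace (\<lambda>z. bracket a (E (bracket y z))) = trace (\<lambda>z. E (bracket y (bracket a z)))"
      using trace_commute[OF linear_bracket(1) Vector_Spaces.linear_compose[OF linear_bracket(1) E], of a y]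
      by (simp add: o_def)
    also have "trace (\<lambda>z. E (bracket a (bracket y z))) - trace (\<lambda>z. E (bracket y (bracket a z))) =
        trace (\<lambda>z. E (bracket (bracket a y) z))"
      using bracket_derivation[of a y]
      by (simp add: E.add trace_add)
    finally show "killing (E a) y = 0" by (simp add: trace_E)
  qed
  then show ?thesis by (auto simp: E_def)
qed

end

section \<open>Root space decomposition\<close>

context lie_algebra
begin

text \<open>A joint eigenvector \<open>v\<close> for \<open>S\<close> splits into eigenvectors
  \<open>w c\<close> of \<open>ad h\<close>. For \<open>s\<close> in \<open>S\<close> with
  eigenvalue \<open>a\<close> on \<open>v\<close>, the operator \<open>ad s - a\<close> commutes
  with \<open>ad h\<close> and kills \<open>v\<close>, so it kills each \<open>w c\<close>
  separately: its values there are eigenvectors of \<open>ad h\<close> with distinct eigenvalues and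
  sum 0.\<close>

lemma joint_eigenvectors_span:
  assumes "abelian t" "\<And>h. h \<in> t \<Longrightarrow> ad_diagonalizable h" "finite S" "S \<subseteq> t"
  shows "span {x. \<forall>h\<in>S. \<exists>c. bracket h x = c *s x} = UNIV"
  using assms(3,4)
proof (induction S rule: finite_induct)
  case empty
  then show ?case by simp
next
  case (insert h S)
  let ?J = "\<lambda>S. {x. \<forall>h\<in>S. \<exists>c. bracket h x = c *s x}"
  have "?J S \<subseteq> span (?J (insert h S))"
  proof
    fix v assume v: "v \<in> ?J S"
    have "v \<in> span {x. \<exists>c. bracket h x = c *s x}"
      using assms(2)[of h] insert.prems by (simp add: ad_diagonalizable_def)
    then have "\<exists>F w. finite F \<and> (\<forall>c\<in>F. bracket h (w c) = c *s w c) \<and> v = (\<Sum>c\<in>F. w c)"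
    proof (induction rule: span_induct_alt)
      case base
      then show ?case by (intro exI[of _ "{}"]) simp
    next
      case (step a x y)
      then obtain F w where Fw: "finite F" "\<forall>c\<in>F. bracket h (w c) = c *s w c" "y = (\<Sum>c\<in>F. w c)"
        by blast
      obtain d where d: "bracket h x = d *s x" using step by blast
      \<comment> \<open>The new eigenvalue \<open>d\<close> may already occur in \<open>F\<close>;
        its vector is then merged with the old summand.\<close>
      let ?w = "\<lambda>c. (if c = d then a *s x else 0) + (if c \<in> F then w c else 0)"
      have "a *s x + y = (\<Sum>c\<in>insert d F. ?w c)"
        using Fw by (simp add: sum.distrib sum.delta' insert_absorb flip: sum.inter_restrict)
          (metis (mono_tags, lifting) Int_absorb1 subset_insertI)
      moreover have "\<forall>c\<in>insert d F. bracket h (?w c) = c *s ?w c"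
        using Fw(2) d by (auto simp: bracket_add_right bracket_scale_right scale_right_distrib mult.commute)
      ultimately show ?case using Fw(1) by (intro exI[of _ "insert d F"] exI[of _ ?w]) auto
    qed
    then obtain F w where F: "finite F" and w: "\<And>c. c \<in> F \<Longrightarrow> bracket h (w c) = c *s w c"
      and v_eq: "v = (\<Sum>c\<in>F. w c)" by blast
    have "w c \<in> ?J (insert h S)" if c: "c \<in> F" for c
    proof -
      have "\<exists>a. bracket s (w c) = a *s w c" if s: "s \<in> S" for s
      proof -
        obtain a where a: "bracket s v = a *s v" using v s by blast
        have "bracket s (w c) - a *s w c = 0"
        proof (rule eigenvectors_sum_eq_0[OF linear_bracket(1)[of h] F inj_on_id2 _ _ c])
          show "(\<Sum>c\<in>F. bracket s (w c) - a *s w c) = 0"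
            using a by (simp add: v_eq sum_subtractf bracket_sum scale_sum_right)
          fix e assume e: "e \<in> F"
          have "bracket h s = 0"
            using assms(1) insert.prems s by (auto simp: abelian_def)
          then have "bracket h (bracket s (w e)) = e *s bracket s (w e)"
            using bracket_derivation[of h s "w e"] w[OF e] by (simp add: bracket_scale_right)
          then show "bracket h (bracket s (w e) - a *s w e) = e *s (bracket s (w e) - a *s w e)"
            using w[OF e]
            by (simp add: bracket_diff bracket_scale_right scale_right_diff_distrib mult.commute)
        qed
        then show ?thesis by auto
      qed
      then show ?thesis using w[OF c] by blast
    qed
    then show "v \<in> span (?J (insert h S))"
      unfolding v_eq by (intro span_sum span_base)
  qed
  then have "span (?J S) \<subseteq> span (?J (insert h S))"
    by (intro span_minimal) auto
  then show ?case using insert by auto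
qed

text \<open>Adjoining the line through \<open>x\<close> to \<open>t\<close> gives an abelian
  subalgebra, so maximality of \<open>t\<close> applies.\<close>

lemma cartan_subalgebra_centralizer:
  assumes "cartan_subalgebra t" "\<And>h. h \<in> t \<Longrightarrow> bracket h x = 0"
  shows "x \<in> t"
proof -
  have t: "subspace t" "\<And>x y. x \<in> t \<Longrightarrow> y \<in> t \<Longrightarrow> bracket x y = 0"
    using assms(1) by (auto simp: cartan_subalgebra_def subalgebra_def abelian_def)
  let ?u = "{h + c *s x | h c. h \<in> t}"
  have sub: "subspace ?u"
  proof (rule subspaceI)
    show "0 \<in> ?u" using t(1) subspace_0 by (metis (mono_tags, lifting) add_0 mem_Collect_eq scale_zero_left)
    fix y z assume "y \<in> ?u" "z \<in> ?u"
    then obtain h c h' c' where *: "y = h + c *s x" "z = h' + c' *s x" "h \<in> t" "h' \<in> t" by blast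
    then have "y + z = (h + h') + (c + c') *s x" by (simp add: scale_left_distrib algebra_simps)
    then show "y + z \<in> ?u" using * t(1) subspace_add by blast
  next
    fix a y assume "y \<in> ?u"
    then obtain h c where *: "y = h + c *s x" "h \<in> t" by blast
    then have "a *s y = a *s h + (a * c) *s x" by (simp add: scale_right_distrib)
    then show "a *s y \<in> ?u" using * t(1) subspace_scale by blast
  qed
  have ab: "bracket y z = 0" if "y \<in> ?u" "z \<in> ?u" for y z
    using that t(2) assms(2)
    by (auto simp: bracket_add_left bracket_add_right bracket_scale_left bracket_scale_right
        bracket_self bracket_skew[of x])
  have "t \<subseteq> ?u"
  proof
    fix h assume "h \<in> t"
    then show "h \<in> ?u" by (intro CollectI exI[of _ h] exI[of _ 0]) simp
  qed
  moreover have "subalgebra ?u" "abelian ?u"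
    using sub ab subspace_0[OF sub] by (simp_all add: subalgebra_def abelian_def)
  ultimately have "?u = t" using assms(1) by (simp add: cartan_subalgebra_def)
  moreover have "x \<in> ?u" using subspace_0[OF t(1)] by (intro CollectI exI[of _ 0] exI[of _ 1]) simp
  ultimately show ?thesis by simp
qed

text \<open>Simultaneous diagonalization handles finitely many operators, hence the finite spanning
  set \<open>C\<close>; a joint eigenvector for \<open>C\<close> is one for all of \<open>t\<close>.
  If its eigenvalue functional is 0, it centralizes \<open>t\<close> and lies in \<open>t\<close>;
  otherwise the functional is a root.\<close>

lemma root_spaces_span:
  assumes "cartan_subalgebra t" "finite C" "C \<subseteq> t" "t \<subseteq> span C"
  shows "span (t \<union> (\<Union>\<gamma>\<in>roots t. root_space t \<gamma>)) = UNIV"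
proof -
  have t: "subspace t" "abelian t" "\<And>h. h \<in> t \<Longrightarrow> ad_diagonalizable h"
    using assms(1) by (auto simp: cartan_subalgebra_def subalgebra_def)
  have "{x. \<forall>h\<in>C. \<exists>c. bracket h x = c *s x} \<subseteq> t \<union> (\<Union>\<gamma>\<in>roots t. root_space t \<gamma>)"
  proof
    fix x assume x: "x \<in> {x. \<forall>h\<in>C. \<exists>c. bracket h x = c *s x}"
    have eig: "\<exists>c. bracket h x = c *s x" if "h \<in> t" for h
    proof -
      have "h \<in> span C" using that assms(4) by blast
      then show ?thesis
      proof (induction rule: span_induct_alt)
        case base
        then show ?case by (auto intro: exI[of _ 0])
      next
        case (step a h h')
        then obtain c c' where "bracket h x = c *s x" "bracket h' x = c' *s x" using x by blast
        then have "bracket (a *s h + h') x = (a * c + c') *s x"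
          by (simp add: bracket_add_left bracket_scale_left scale_left_distrib)
        then show ?case by blast
      qed
    qed
    show "x \<in> t \<union> (\<Union>\<gamma>\<in>roots t. root_space t \<gamma>)"
    proof (cases "x \<in> t")
      case False
      then have x0: "x \<noteq> 0" using subspace_0[OF t(1)] by auto
      \<comment> \<open>The eigenvalue is unique because \<open>x\<close> is nonzero, which makes
        the choice linear on \<open>t\<close>; the value 0 elsewhere is the convention of
        \<open>dual_space\<close>.\<close>
      define \<gamma> where "\<gamma> h = (if h \<in> t then SOME c. bracket h x = c *s x else 0)" for h
      have \<gamma>: "bracket h x = \<gamma> h *s x" if "h \<in> t" for h
        using someI_ex[OF eig[OF that]] that by (simp add: \<gamma>_def)
      have \<gamma>_eq: "\<gamma> h = c" if "h \<in> t" "bracket h x = c *s x" for h c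
        using \<gamma>[OF that(1)] that(2) x0 by simp
      have "\<gamma> \<in> dual_space t"
        unfolding dual_space_def
      proof (intro CollectI conjI allI ballI impI)
        fix h h' assume h: "h \<in> t" "h' \<in> t"
        show "\<gamma> (h + h') = \<gamma> h + \<gamma> h'"
          using h t(1) by (intro \<gamma>_eq) (auto simp: bracket_add_left \<gamma> scale_left_distrib subspace_add)
      next
        fix c h assume h: "h \<in> t"
        show "\<gamma> (c *s h) = c * \<gamma> h"
          using h t(1) by (intro \<gamma>_eq) (auto simp: bracket_scale_left \<gamma> subspace_scale)
      qed (simp add: \<gamma>_def)
      moreover have "\<gamma> \<noteq> (\<lambda>_. 0)"
      proof
        assume "\<gamma> = (\<lambda>_. 0)"
        then have "x \<in> t" using \<gamma> by (intro cartan_subalgebra_centralizer[OF assms(1)]) simp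
        with False show False by simp
      qed
      moreover have xr: "x \<in> root_space t \<gamma>" using \<gamma> by (simp add: root_space_def)
      ultimately have "\<gamma> \<in> roots t" using x0 by (auto simp: roots_def)
      with xr show ?thesis by blast
    qed simp
  qed
  then show ?thesis
    using span_mono joint_eigenvectors_span[OF t(2,3) assms(2,3)] by blast
qed

end

section \<open>Nondegeneracy of the Killing form, symmetry of the roots, and the bound on
  degrees\<close>

locale root_basis = simple_lie_algebra scale bracket + finite_dim_lie_algebra scale bracket Basis
  for scale :: "'k::field_char_0 \<Rightarrow> 'v::ab_group_add \<Rightarrow> 'v" (infixr \<open>*s\<close> 75)
    and bracket :: "'v \<Rightarrow> 'v \<Rightarrow> 'v" and Basis :: "'v set" +
  fixes t :: "'v set" and \<alpha> :: "nat \<Rightarrow> 'v \<Rightarrow> 'k" and l :: nat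
  assumes cartan: "cartan_subalgebra t"
    and simple: "simple_roots t \<alpha> l"
    and Basis_root_vectors: "Basis \<subseteq> t \<union> (\<Union>\<gamma>\<in>roots t. root_space t \<gamma>)"
begin

text \<open>The functional by which \<open>t\<close> acts on a basis vector, by
  \<open>bracket_Basis\<close>. It turns the Killing form on \<open>t\<close> into a sum of products
  of weights.\<close>

definition weight :: "'v \<Rightarrow> 'v \<Rightarrow> 'k" where
  "weight b = (if b \<in> t then (\<lambda>_. 0) else SOME \<gamma>. \<gamma> \<in> roots t \<and> b \<in> root_space t \<gamma>)"

lemma weight_in_roots:
  assumes "b \<in> Basis" "b \<notin> t"
  shows "weight b \<in> roots t" "b \<in> root_space t (weight b)"
proof -
  have "\<exists>\<gamma>. \<gamma> \<in> roots t \<and> b \<in> root_space t \<gamma>" using assms Basis_root_vectors by blast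
  from someI_ex[OF this] show "weight b \<in> roots t" "b \<in> root_space t (weight b)"
    using assms(2) by (simp_all add: weight_def)
qed

lemma weight_0: "b \<in> t \<Longrightarrow> weight b = (\<lambda>_. 0)"
  by (simp add: weight_def)

lemma bracket_cartan: "h \<in> t \<Longrightarrow> h' \<in> t \<Longrightarrow> bracket h h' = 0"
  using cartan by (auto simp: cartan_subalgebra_def abelian_def)

lemma subspace_cartan: "subspace t"
  using cartan by (auto simp: cartan_subalgebra_def subalgebra_def)

lemma bracket_Basis: "h \<in> t \<Longrightarrow> b \<in> Basis \<Longrightarrow> bracket h b = weight b h *s b"
  using weight_in_roots[of b] by (cases "b \<in> t") (auto simp: weight_0 bracket_cartan root_space_def)

lemma root_outside: "\<gamma> \<in> roots t \<Longrightarrow> h \<notin> t \<Longrightarrow> \<gamma> h = 0"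
  by (auto simp: roots_def dual_space_def)

lemma weight_outside: "b \<in> Basis \<Longrightarrow> h \<notin> t \<Longrightarrow> weight b h = 0"
  using weight_in_roots[of b] root_outside by (cases "b \<in> t") (auto simp: weight_0)

lemma killing_cartan:
  assumes "h \<in> t" "h' \<in> t"
  shows "killing h h' = (\<Sum>b\<in>Basis. weight b h * weight b h')"
  unfolding killing_def trace_def
proof (rule sum.cong)
  fix b assume b: "b \<in> Basis"
  then have "bracket h (bracket h' b) = (weight b h * weight b h') *s b"
    using assms by (simp add: bracket_Basis bracket_scale_right mult.commute)
  then show "representation Basis (bracket h (bracket h' b)) b = weight b h * weight b h'"
    using b by (simp add: representation_scale representation_basis independent_Basis)
qed simp

lemma simple_independent: "lin_comb \<alpha> l c = (\<lambda>_. 0) \<Longrightarrow> i \<in> {1..l} \<Longrightarrow> c i = 0"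
  using simple by (simp add: simple_roots_def)

lemma weight_integral:
  assumes "b \<in> Basis"
  shows "\<exists>c::nat \<Rightarrow> int. weight b = lin_comb \<alpha> l (\<lambda>i. of_int (c i))"
proof (cases "b \<in> t")
  case True
  then show ?thesis by (intro exI[of _ "\<lambda>_. 0"]) (simp add: weight_0 lin_comb_def)
next
  case False
  then show ?thesis using weight_in_roots[OF assms] simple by (auto simp: simple_roots_def)
qed

text \<open>Rewrites a combination of weights in terms of simple roots, so that
  \<open>simple_independent\<close> can extract its coefficients.\<close>

lemma lin_comb_weights:
  assumes "\<And>b. b \<in> Basis \<Longrightarrow> weight b = lin_comb \<alpha> l (c b)"
  shows "lin_comb \<alpha> l (\<lambda>i. \<Sum>b\<in>Basis. a b * c b i) = (\<lambda>h. \<Sum>b\<in>Basis. a b * weight b h)"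
proof
  fix h
  have "lin_comb \<alpha> l (\<lambda>i. \<Sum>b\<in>Basis. a b * c b i) h = (\<Sum>b\<in>Basis. \<Sum>i=1..l. a b * c b i * \<alpha> i h)"
    unfolding lin_comb_def by (subst sum.swap) (simp add: sum_distrib_right)
  also have "\<dots> = (\<Sum>b\<in>Basis. a b * weight b h)"
    by (rule sum.cong) (simp_all add: assms lin_comb_def sum_distrib_left mult.assoc)
  finally show "lin_comb \<alpha> l (\<lambda>i. \<Sum>b\<in>Basis. a b * c b i) h = (\<Sum>b\<in>Basis. a b * weight b h)" .
qed

text \<open>Roots being integral combinations of the simple ones, the coefficients of the Killing form
  on \<open>t\<close> with respect to the products of simple roots are \<open>\<Sum>b. c b i * c b j\<close>; the diagonal ones
  are sums of squares of integers. This replaces Cartan's criterion.\<close>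

lemma killing_nonzero: "\<exists>x y. killing x y \<noteq> 0"
proof (rule ccontr)
  assume "\<nexists>x y. killing x y \<noteq> 0"
  then have kill: "(\<Sum>b\<in>Basis. weight b h' * weight b h) = 0" for h h'
    using killing_cartan[of h' h] by (cases "h \<in> t \<and> h' \<in> t") (auto simp: weight_outside)
  obtain c :: "'v \<Rightarrow> nat \<Rightarrow> int" where
    c: "\<And>b. b \<in> Basis \<Longrightarrow> weight b = lin_comb \<alpha> l (\<lambda>i. of_int (c b i))"
    using weight_integral by metis
  have "c b i = 0" if b: "b \<in> Basis" and i: "i \<in> {1..l}" for b i
  proof -
    \<comment> \<open>Independence of the simple roots is applied once for each argument of the
      form: now with \<open>h\<close> fixed, then to the resulting functionals of \<open>h\<close>.
      What remains is an identity between integers.\<close>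
    have "lin_comb \<alpha> l (\<lambda>i. \<Sum>b\<in>Basis. weight b h * of_int (c b i)) = (\<lambda>_. 0)" for h
      using lin_comb_weights[OF c, of "\<lambda>b. weight b h"] by (simp add: kill)
    from simple_independent[OF this i]
    have "(\<Sum>b\<in>Basis. of_int (c b i) * weight b h) = 0" for h
      by (simp add: mult.commute)
    then have "lin_comb \<alpha> l (\<lambda>j. \<Sum>b\<in>Basis. of_int (c b i) * of_int (c b j)) = (\<lambda>_. 0)"
      using lin_comb_weights[OF c, of "\<lambda>b. of_int (c b i)"] by simp
    from simple_independent[OF this i]
    have "of_int (\<Sum>b\<in>Basis. c b i * c b i) = (0 :: 'k)" by simp
    then have "(\<Sum>b\<in>Basis. c b i * c b i) = 0" by (simp only: of_int_eq_0_iff)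
    then show "c b i = 0" using b by (subst (asm) sum_nonneg_eq_0_iff) (auto simp: finite_Basis)
  qed
  then have "weight b = (\<lambda>_. 0)" if "b \<in> Basis" for b
    using c that by (simp add: lin_comb_def)
  \<comment> \<open>If all weights were 0, the whole algebra would be the abelian subalgebra
    \<open>t\<close>.\<close>
  then have "Basis \<subseteq> t"
    using weight_in_roots(1) by (fastforce simp: roots_def)
  then have "t = UNIV"
    using span_minimal[OF _ subspace_cartan] span_Basis by blast
  then have "abelian UNIV" using cartan by (simp add: cartan_subalgebra_def)
  then show False using nonabelian by simp
qed

lemma killing_nondegenerate:
  assumes "\<And>y. killing x y = 0"
  shows "x = 0"
  using ideal_trivial[OF ideal_killing_radical] killing_nonzero assms by blast

text \<open>By nondegeneracy a nonzero vector \<open>x\<close> of the root space pairs nontrivially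
  with some basis vector \<open>b\<close>, and moving \<open>ad h\<close> from \<open>x\<close> to
  \<open>b\<close> by invariance forces \<open>b\<close> to have the opposite weight.\<close>

lemma root_minus:
  assumes "\<gamma> \<in> roots t"
  shows "(\<lambda>h. - \<gamma> h) \<in> roots t"
proof -
  obtain x where x: "x \<in> root_space t \<gamma>" "x \<noteq> 0"
  proof -
    have "0 \<in> root_space t \<gamma>" by (simp add: root_space_def)
    then show thesis using that assms by (auto simp: roots_def)
  qed
  then obtain b where b: "b \<in> Basis" "killing x b \<noteq> 0"
    using killing_nondegenerate[of x] functional_eq_0I[of "killing x"]
    by (auto simp: killing_add killing_scale)
  have "weight b h = - \<gamma> h" for h
  proof (cases "h \<in> t")
    case True
    then have "killing (bracket x h) b = - \<gamma> h * killing x b"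
      using x by (simp add: bracket_skew[of x h] root_space_def killing_minus killing_scale)
    moreover have "killing x (bracket h b) = weight b h * killing x b"
      using True b by (simp add: bracket_Basis killing_scale)
    ultimately have "weight b h * killing x b = - \<gamma> h * killing x b"
      by (simp only: killing_invariant)
    then show ?thesis using b(2) by (simp only: mult_cancel_right simp_thms)
  next
    case False
    then show ?thesis using b root_outside[OF assms] weight_outside by simp
  qed
  then have w: "weight b = (\<lambda>h. - \<gamma> h)" ..
  moreover have "b \<notin> t"
  proof
    assume "b \<in> t"
    then have "\<gamma> = (\<lambda>_. 0)" using w by (simp add: weight_0 fun_eq_iff)
    then show False using assms by (simp add: roots_def)
  qed
  ultimately show ?thesis using weight_in_roots[OF b(1)] by simp
qed

lemma root_coeff_eqI:
  assumes "\<And>i. i \<notin> {1..l} \<Longrightarrow> c i = 0" "\<gamma> = lin_comb \<alpha> l (\<lambda>i. of_int (c i))"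
  shows "root_coeff \<alpha> l \<gamma> = c"
  unfolding root_coeff_def
proof (rule the_equality)
  fix d :: "nat \<Rightarrow> int"
  assume d: "(\<forall>i. i \<notin> {1..l} \<longrightarrow> d i = 0) \<and> \<gamma> = lin_comb \<alpha> l (\<lambda>i. of_int (d i))"
  then have eq: "lin_comb \<alpha> l (\<lambda>i. of_int (d i)) h = lin_comb \<alpha> l (\<lambda>i. of_int (c i)) h" for h
    using assms by simp
  have "lin_comb \<alpha> l (\<lambda>i. of_int (d i) - of_int (c i)) = (\<lambda>_. 0)"
    using eq by (simp add: lin_comb_def left_diff_distrib sum_subtractf)
  from simple_independent[OF this] have "d i = c i" for i
    using d assms(1)[of i] by (cases "i \<in> {1..l}") simp_all
  then show "d = c" ..
qed (use assms in auto)

lemma root_coeff: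
  assumes "\<gamma> \<in> roots t"
  shows "\<gamma> = lin_comb \<alpha> l (\<lambda>i. of_int (root_coeff \<alpha> l \<gamma> i))" "i \<notin> {1..l} \<Longrightarrow> root_coeff \<alpha> l \<gamma> i = 0"
proof -
  obtain c :: "nat \<Rightarrow> int" where c: "\<gamma> = lin_comb \<alpha> l (\<lambda>i. of_int (c i))"
    using assms simple by (auto simp: simple_roots_def)
  have "root_coeff \<alpha> l \<gamma> = (\<lambda>i. if i \<in> {1..l} then c i else 0)"
    by (rule root_coeff_eqI) (auto simp: c lin_comb_def)
  then show "\<gamma> = lin_comb \<alpha> l (\<lambda>i. of_int (root_coeff \<alpha> l \<gamma> i))" "i \<notin> {1..l} \<Longrightarrow> root_coeff \<alpha> l \<gamma> i = 0"
    by (auto simp: c lin_comb_def)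
qed

lemma root_coeff_minus:
  assumes "\<gamma> \<in> roots t"
  shows "root_coeff \<alpha> l (\<lambda>h. - \<gamma> h) = (\<lambda>i. - root_coeff \<alpha> l \<gamma> i)"
proof (rule root_coeff_eqI)
  show "(\<lambda>h. - \<gamma> h) = lin_comb \<alpha> l (\<lambda>i. of_int (- root_coeff \<alpha> l \<gamma> i))"
    by (subst root_coeff(1)[OF assms]) (simp add: lin_comb_def sum_negf)
qed (simp add: root_coeff(2)[OF assms])

text \<open>Since \<open>n_0 = 1\<close>, the order is \<open>p 0\<close> plus an upper bound for
  all degrees, and \<open>p 0 > 0\<close> makes the inequality strict. The lower bound is the upper
  one for the opposite root.\<close>

lemma kac_degree_bound:
  assumes "highest_root t \<alpha> l \<delta>" "p 0 > 0" "\<gamma> \<in> roots t"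
  shows "\<bar>kac_degree \<alpha> l p \<gamma>\<bar> < int (kac_order \<alpha> l \<delta> p)"
proof -
  have upper: "kac_degree \<alpha> l p \<gamma> < int (kac_order \<alpha> l \<delta> p)" if "\<gamma> \<in> roots t" for \<gamma>
  proof -
    have "kac_degree \<alpha> l p \<gamma> \<le> (\<Sum>i=1..l. int (highest_coeff \<alpha> l \<delta> i) * int (p i))"
      unfolding kac_degree_def
    proof (intro sum_mono mult_right_mono)
      fix i assume i: "i \<in> {1..l}"
      then have "root_coeff \<alpha> l \<gamma> i \<le> root_coeff \<alpha> l \<delta> i"
        using assms(1) that by (auto simp: highest_root_def)
      \<comment> \<open>The truncation \<open>nat\<close> in \<open>highest_coeff\<close> can only
        enlarge the coefficient.\<close>
      then show "root_coeff \<alpha> l \<gamma> i \<le> int (highest_coeff \<alpha> l \<delta> i)"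
        using i by (simp add: highest_coeff_def)
    qed simp
    also have "\<dots> < int (p 0) + \<dots>" using assms(2) by simp
    also have "\<dots> = int (kac_order \<alpha> l \<delta> p)"
      by (simp add: kac_order_def sum.atLeast_Suc_atMost[of 0 l] highest_coeff_def)
    finally show ?thesis .
  qed
  moreover have "kac_degree \<alpha> l p (\<lambda>h. - \<gamma> h) = - kac_degree \<alpha> l p \<gamma>"
    by (simp add: kac_degree_def root_coeff_minus[OF assms(3)] sum_negf)
  ultimately show ?thesis using upper[OF assms(3)] upper[OF root_minus[OF assms(3)]] by linarith
qed

end

section \<open>Gradings\<close>

context lie_algebra
begin

lemma lie_grading_direct_decomposition: "lie_grading G \<Longrightarrow> direct_decomposition scale UNIV G"
  by (simp add: direct_decomposition_def direct_decomposition_axioms_def lie_grading_def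
      vector_space_axioms)

lemma bracket_grading: "lie_grading G \<Longrightarrow> x \<in> G i \<Longrightarrow> y \<in> G j \<Longrightarrow> bracket x y \<in> G (i + j)"
  by (simp add: lie_grading_def)

lemma grading_span:
  assumes "lie_grading G"
  shows "span (\<Union>j. G j) = UNIV"
proof -
  interpret G: direct_decomposition scale UNIV G
    using assms by (rule lie_grading_direct_decomposition)
  have "x \<in> span (\<Union>j. G j)" for x
    using span_sum[of "{i. component UNIV G x i \<noteq> 0}" "component UNIV G x" "\<Union>j. G j"]
      G.component_mem[of _ x] G.sum_component[OF G.finite_component subset_refl, of x]
    by (metis (no_types, lifting) UN_I UNIV_I span_base)
  then show ?thesis by blast
qed

lemma grading_complements:
  assumes "lie_grading G"
  shows "complements scale (nonneg_part G) (neg_part G)"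
proof -
  interpret G: direct_decomposition scale UNIV G
    using assms by (rule lie_grading_direct_decomposition)
  \<comment> \<open>Used with \<open>A\<close> the nonnegative and then the negative integers: a
    vector in both parts has no nonzero component.\<close>
  have vanish: "component UNIV G x j = 0" if x: "x \<in> span (\<Union>i\<in>A. G i)" and j: "j \<notin> A" for x j and A :: "int set"
  proof -
    interpret c: Vector_Spaces.linear scale scale "\<lambda>x. component UNIV G x j"
      by (rule G.linear_component)
    show ?thesis using x
    proof (induction rule: span_induct_alt)
      case (step c x y)
      then obtain i where "x \<in> G i" "i \<noteq> j" using j by blast
      then have "component UNIV G x j = 0" using G.component_summand[of i x] by simp
      then show ?case using step by (simp add: c.add c.scale)
    qed (rule c.zero)
  qed
  show ?thesis
  proof
    fix x
    show "x = 0" if "x \<in> nonneg_part G" "x \<in> neg_part G"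
    proof -
      have "component UNIV G x j = 0" for j
        using vanish[of x "{0..}" j] vanish[of x "{..<0}" j] that
        by (cases "j \<ge> 0") (auto simp: nonneg_part_def neg_part_def)
      then show ?thesis using G.sum_component[of "{}" x] by simp
    qed
    have mem: "component UNIV G x j \<in> span (\<Union>j\<in>A. G j)" if "j \<in> A" for j A
      using that G.component_mem[OF UNIV_I] by (rule span_base[OF UN_I])
    let ?S = "{j. component UNIV G x j \<noteq> 0}"
    have "(\<Sum>j\<in>?S \<inter> {0..}. component UNIV G x j) + (\<Sum>j\<in>?S - {0..}. component UNIV G x j) = x"
      using G.sum_component[OF G.finite_component subset_refl, of x]
        sum.Int_Diff[OF G.finite_component, of "component UNIV G x" x "{0..}"] by simp
    then have "x - (\<Sum>j\<in>?S \<inter> {0..}. component UNIV G x j) = (\<Sum>j\<in>?S - {0..}. component UNIV G x j)"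
      by (simp add: algebra_simps)
    also have "\<dots> \<in> neg_part G"
      unfolding neg_part_def by (intro span_sum mem) auto
    finally show "\<exists>u\<in>nonneg_part G. x - u \<in> neg_part G"
    proof (rule bexI)
      show "(\<Sum>j\<in>?S \<inter> {0..}. component UNIV G x j) \<in> nonneg_part G"
        unfolding nonneg_part_def by (intro span_sum mem) auto
    qed
  qed (simp_all add: nonneg_part_def neg_part_def)
qed

lemma subalgebra_nonneg_part:
  assumes "lie_grading G"
  shows "subalgebra (nonneg_part G)"
  unfolding subalgebra_def
proof (intro conjI ballI)
  show sub: "subspace (nonneg_part G)" by (simp add: nonneg_part_def)
  fix x y assume xy: "x \<in> nonneg_part G" "y \<in> nonneg_part G"
  have hom: "bracket x y \<in> nonneg_part G" if x: "x \<in> (\<Union>j\<in>{0..}. G j)" for x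
    using xy(2) unfolding nonneg_part_def
  proof (induction rule: span_induct_alt)
    case (step c u v)
    then obtain i j where "x \<in> G i" "u \<in> G j" "i \<ge> 0" "j \<ge> 0" using x by auto
    then have "bracket x u \<in> span (\<Union>j\<in>{0..}. G j)"
      using bracket_grading[OF assms] by (intro span_base UN_I[of "i + j"]) auto
    with step show ?case
      by (simp add: bracket_add_right bracket_scale_right span_add span_scale)
  qed (simp add: span_zero)
  show "bracket x y \<in> nonneg_part G"
    using xy(1) unfolding nonneg_part_def
  proof (induction rule: span_induct_alt)
    case (step c u v)
    then show ?case using hom[of u]
      by (simp add: nonneg_part_def bracket_add_left bracket_scale_left span_add span_scale)
  qed (simp add: span_zero)
qed

end

section \<open>The degree derivation and the degrees of root spaces\<close>

context root_basis
begin

text \<open>The derivation rule expresses that degrees add under the bracket. In characteristic 0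
  distinct integers stay distinct in the field, so the graded pieces are recovered exactly as
  eigenspaces of \<open>D\<close>.\<close>

lemma grading_derivation:
  assumes "lie_grading G"
  obtains D where "Vector_Spaces.linear scale scale D"
    "\<And>x y. D (bracket x y) = bracket (D x) y + bracket x (D y)"
    "\<And>j x. x \<in> G j \<longleftrightarrow> D x = of_int j *s x"
proof -
  interpret G: direct_decomposition scale UNIV G
    using assms by (rule lie_grading_direct_decomposition)
  \<comment> \<open>The finitely many degrees that occur in basis vectors; by linearity no other
    degree occurs in any vector, so one finite sum defines \<open>D\<close> everywhere.\<close>
  let ?J = "\<Union>b\<in>Basis. {j. component UNIV G b j \<noteq> 0}"
  have fin: "finite ?J" using finite_Basis G.finite_component by blast
  have supp: "{j. component UNIV G x j \<noteq> 0} \<subseteq> ?J" for x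
  proof
    fix j assume j: "j \<in> {j. component UNIV G x j \<noteq> 0}"
    show "j \<in> ?J"
    proof (rule ccontr)
      assume "j \<notin> ?J"
      then have "component UNIV G x j = 0"
        using linear_eqI_on_span[OF G.linear_component, of "\<lambda>_. 0" Basis j x]
        by (simp add: Vector_Spaces.linear_iff vector_space_axioms span_Basis)
      with j show False by simp
    qed
  qed
  define D where "D x = (\<Sum>j\<in>?J. of_int j *s component UNIV G x j)" for x
  have lin: "component UNIV G (x + y) j = component UNIV G x j + component UNIV G y j"
    "component UNIV G (c *s x) j = c *s component UNIV G x j" for x y c j
    using G.linear_component by (auto simp: Vector_Spaces.linear_iff)
  have D: "Vector_Spaces.linear scale scale D"
    by (simp add: Vector_Spaces.linear_iff vector_space_axioms D_def lin scale_right_distrib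
        sum.distrib scale_sum_right mult.commute)
  interpret D: Vector_Spaces.linear scale scale D by (rule D)
  have D_hom: "D x = of_int j *s x" if "x \<in> G j" for j x
  proof -
    have c: "component UNIV G x = (\<lambda>i. if i = j then x else 0)"
      using that by (intro G.component_summand) auto
    have "D x = (\<Sum>i\<in>?J. if i = j then of_int j *s x else 0)"
      unfolding D_def c by (rule sum.cong) auto
    also have "\<dots> = (if j \<in> ?J then of_int j *s x else 0)"
      using fin by simp
    also have "\<dots> = of_int j *s x"
      using subsetD[OF supp[of x], of j] by (cases "x = 0") (simp_all add: c)
    finally show ?thesis .
  qed
  show thesis
  proof
    show "Vector_Spaces.linear scale scale D" by (rule D)
    show "D (bracket x y) = bracket (D x) y + bracket x (D y)" for x y
    proof (rule bilinear_eqI_on_span[where f = "\<lambda>x y. D (bracket x y)" and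
          g = "\<lambda>x y. bracket (D x) y + bracket x (D y)",
        OF _ _ _ _ _ grading_span[OF assms]])
      fix a b assume "a \<in> (\<Union>j. G j)" "b \<in> (\<Union>j. G j)"
      then obtain i j where "a \<in> G i" "b \<in> G j" by blast
      then show "D (bracket a b) = bracket (D a) b + bracket a (D b)"
        using D_hom[OF bracket_grading[OF assms], of a i b j]
        by (simp add: D_hom bracket_scale_left bracket_scale_right scale_left_distrib)
    qed (simp_all add: Vector_Spaces.linear_iff vector_space_axioms D.add D.scale bracket_add_left
        bracket_add_right bracket_scale_left bracket_scale_right scale_right_distrib)
    show "x \<in> G j \<longleftrightarrow> D x = of_int j *s x" for x j
    proof
      assume Dx: "D x = of_int j *s x"
      have sum_x: "(\<Sum>i\<in>?J. component UNIV G x i) = x"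
        by (rule G.sum_component[OF fin supp])
      have "component UNIV G x i = 0" if "i \<noteq> j" for i
      proof (cases "i \<in> ?J")
        case True
        \<comment> \<open>The components of \<open>D x - j x = 0\<close> are eigenvectors of
          \<open>D\<close> with distinct eigenvalues, so each is 0, and \<open>x\<close> has no
          component in a degree other than \<open>j\<close>.\<close>
        have "(\<Sum>i\<in>?J. (of_int i - of_int j) *s component UNIV G x i) =
            D x - of_int j *s (\<Sum>i\<in>?J. component UNIV G x i)"
          unfolding D_def by (simp only: scale_left_diff_distrib sum_subtractf scale_sum_right)
        also have "\<dots> = 0" by (simp only: sum_x Dx diff_self)
        finally have "(of_int i - of_int j) *s component UNIV G x i = 0"
          using D_hom[OF G.component_mem] True
          by (intro eigenvectors_sum_eq_0[OF D fin, where c = of_int and i = i and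
                w = "\<lambda>i. (of_int i - of_int j) *s component UNIV G x i"])
            (auto simp: D.scale mult.commute inj_on_def)
        then show ?thesis using that by simp
      qed (use supp[of x] in blast)
      then have "x = component UNIV G x j"
        using G.sum_component[of "{j}" x] by fastforce
      then show "x \<in> G j" using G.component_mem[of j x] by simp
    qed (rule D_hom)
  qed
qed

lemma root_space_grading:
  assumes G: "lie_grading G" "t \<subseteq> G 0" "\<And>i. i \<in> {1..l} \<Longrightarrow> root_space t (\<alpha> i) \<subseteq> G (int (p i))"
    and \<gamma>: "\<gamma> \<in> roots t"
  shows "root_space t \<gamma> \<subseteq> G (kac_degree \<alpha> l p \<gamma>)"
proof -
  obtain D where D: "Vector_Spaces.linear scale scale D"
    "\<And>x y. D (bracket x y) = bracket (D x) y + bracket x (D y)"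
    and G_iff: "\<And>j x. x \<in> G j \<longleftrightarrow> D x = of_int j *s x"
    using grading_derivation[OF G(1)] by blast
  obtain h where h: "\<And>x. D x = bracket h x"
    using derivation_inner[OF killing_nondegenerate D] by blast
  \<comment> \<open>\<open>D\<close> vanishes on \<open>t\<close>, which lies in degree 0, so
    \<open>h\<close> commutes with \<open>t\<close>.\<close>
  have "h \<in> t"
  proof (rule cartan_subalgebra_centralizer[OF cartan])
    fix h' assume "h' \<in> t"
    then have "D h' = 0" using G(2) G_iff[of h' 0] by auto
    then show "bracket h' h = 0" by (simp add: h bracket_skew[of h' h])
  qed
  have \<alpha>_h: "\<alpha> i h = of_nat (p i)" if i: "i \<in> {1..l}" for i
  proof -
    have "\<alpha> i \<in> roots t" using simple i by (simp add: simple_roots_def)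
    moreover have "0 \<in> root_space t (\<alpha> i)" by (simp add: root_space_def)
    ultimately obtain x where x: "x \<in> root_space t (\<alpha> i)" "x \<noteq> 0" by (auto simp: roots_def)
    then have "bracket h x = of_int (int (p i)) *s x" using G(3)[OF i] by (auto simp: G_iff h)
    moreover have "bracket h x = \<alpha> i h *s x" using x(1) \<open>h \<in> t\<close> by (simp add: root_space_def)
    ultimately show ?thesis using x(2) by simp
  qed
  have "\<gamma> h = (\<Sum>i=1..l. of_int (root_coeff \<alpha> l \<gamma> i) * \<alpha> i h)"
    by (subst root_coeff(1)[OF \<gamma>]) (simp add: lin_comb_def)
  then have "\<gamma> h = of_int (kac_degree \<alpha> l p \<gamma>)"
    by (simp add: \<alpha>_h kac_degree_def)
  then show ?thesis
    using \<open>h \<in> t\<close> by (auto simp: G_iff h root_space_def)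
qed

end

section \<open>The contraction\<close>

context lie_algebra
begin

text \<open>The index set of the sum in \<open>exp_ad\<close> depends on the argument. Nilpotency
  gives one bound \<open>n\<close> for all arguments, and the sum below \<open>n\<close> is linear
  term by term.\<close>

lemma linear_exp_ad:
  assumes "ad_nilpotent x"
  shows "Vector_Spaces.linear scale scale (exp_ad x)"
proof -
  obtain n where n: "\<And>y. (bracket x ^^ n) y = 0" using assms by (auto simp: ad_nilpotent_def)
  have "(bracket x ^^ (m + n)) y = 0" for m y
    by (induction m) (simp_all add: n)
  then have large: "(bracket x ^^ k) y = 0" if "\<not> k < n" for k y
    using that by (metis le_add_diff_inverse2 not_less)
  have "exp_ad x y = (\<Sum>k<n. (1 / of_nat (fact k)) *s (bracket x ^^ k) y)" for y
    unfolding exp_ad_def by (rule sum.mono_neutral_left) (use large in auto)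
  moreover have "(bracket x ^^ k) (y + z) = (bracket x ^^ k) y + (bracket x ^^ k) z" for k y z
    by (induction k) (simp_all add: bracket_add_right)
  moreover have "(bracket x ^^ k) (c *s y) = c *s (bracket x ^^ k) y" for k c y
    by (induction k) (simp_all add: bracket_scale_right)
  ultimately show ?thesis
    by (simp add: Vector_Spaces.linear_iff vector_space_axioms scale_right_distrib sum.distrib
        scale_sum_right mult.commute)
qed

lemma linear_inner_automorphism:
  "inner_automorphism \<phi> \<Longrightarrow> Vector_Spaces.linear scale scale \<phi>"
  by (induction rule: inner_automorphism.induct)
    (auto simp: Vector_Spaces.linear_iff vector_space_axioms dest!: linear_exp_ad)

lemma primitive_root_inj:
  assumes "primitive_root_of_unity m (\<zeta> :: 'k)"
  shows "inj_on (\<lambda>i. \<zeta> ^ i) {0..<m}"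
proof (rule linorder_inj_onI)
  fix i j :: nat assume ij: "i < j" "i \<in> {0..<m}" "j \<in> {0..<m}"
  have "\<zeta> \<noteq> 0" using assms by (auto simp: primitive_root_of_unity_def power_0_left)
  moreover have "j - i \<in> {1..<m}" using ij by auto
  then have "\<zeta> ^ (j - i) \<noteq> 1" using assms by (simp add: primitive_root_of_unity_def)
  moreover have "\<zeta> ^ j = \<zeta> ^ i * \<zeta> ^ (j - i)" using ij by (simp flip: power_add)
  ultimately show "\<zeta> ^ i \<noteq> \<zeta> ^ j" by auto
qed auto

text \<open>Spanning gives existence; uniqueness holds because the powers of \<open>\<zeta>\<close>
  below \<open>m\<close> are distinct eigenvalues.\<close>

lemma eigenspaces_direct_decomposition:
  assumes \<theta>: "Vector_Spaces.linear scale scale \<theta>" and \<zeta>: "primitive_root_of_unity m \<zeta>"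
    and span: "span (\<Union>i<m. eigenspace \<theta> (\<zeta> ^ i)) = UNIV"
  shows "direct_decomposition scale {0..<m} (\<lambda>i. eigenspace \<theta> (\<zeta> ^ i))"
proof
  interpret \<theta>: Vector_Spaces.linear scale scale \<theta> by (rule \<theta>)
  let ?V = "\<lambda>i. eigenspace \<theta> (\<zeta> ^ i)"
  show sub: "subspace (?V i)" for i
    by (auto simp: subspace_def eigenspace_def \<theta>.zero \<theta>.add \<theta>.scale scale_right_distrib mult.commute)
  fix x
  have "x \<in> span (\<Union>i<m. ?V i)" using span by simp
  then have "\<exists>f. is_decomposition {0..<m} ?V x f"
  proof (induction rule: span_induct_alt)
    case base
    show ?case by (intro exI[of _ "\<lambda>_. 0"]) (simp add: is_decomposition_def eigenspace_def \<theta>.zero)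
  next
    case (step c x y)
    then obtain i f where "i < m" "x \<in> ?V i" "is_decomposition {0..<m} ?V y f" by blast
    then have "is_decomposition {0..<m} ?V (c *s x + y) (\<lambda>k. c *s (if k = i then x else 0) + f k)"
      using sub
      by (intro is_decomposition_add is_decomposition_scale is_decomposition_single) auto
    then show ?case by blast
  qed
  moreover have "f = g"
    if f: "is_decomposition {0..<m} ?V x f" and g: "is_decomposition {0..<m} ?V x g" for f g
  proof
    fix i
    show "f i = g i"
    proof (cases "i \<in> {0..<m}")
      case True
      have supp: "{i. f i \<noteq> 0} \<subseteq> {0..<m}" "{i. g i \<noteq> 0} \<subseteq> {0..<m}"
        using f g by (auto simp: is_decomposition_def)
      have "f i - g i = 0"
      proof (rule eigenvectors_sum_eq_0[OF \<theta> _ primitive_root_inj[OF \<zeta>] _ _ True])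
        show "(\<Sum>i\<in>{0..<m}. f i - g i) = 0"
          using is_decomposition_sum[OF f _ supp(1)] is_decomposition_sum[OF g _ supp(2)]
          by (simp add: sum_subtractf)
        show "\<theta> (f i - g i) = (\<zeta> ^ i) *s (f i - g i)" if "i \<in> {0..<m}" for i
          using f g that
          by (simp add: is_decomposition_def eigenspace_def \<theta>.diff scale_right_diff_distrib)
      qed simp
      then show ?thesis by simp
    qed (use f g in \<open>simp add: is_decomposition_def\<close>)
  qed
  ultimately show "\<exists>!f. is_decomposition {0..<m} ?V x f" by blast
qed

lemma linear_contracted_bracket:
  assumes "direct_decomposition scale {0..<m} (\<lambda>i. eigenspace \<theta> (\<zeta> ^ i))"
  shows "Vector_Spaces.linear scale scale (contracted_bracket \<theta> m \<zeta> x)"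
    "Vector_Spaces.linear scale scale (\<lambda>x. contracted_bracket \<theta> m \<zeta> x y)"
proof -
  interpret direct_decomposition scale "{0..<m}" "\<lambda>i. eigenspace \<theta> (\<zeta> ^ i)" by fact
  have lin: "eigen_component \<theta> m \<zeta> (x + y) i = eigen_component \<theta> m \<zeta> x i + eigen_component \<theta> m \<zeta> y i"
    "eigen_component \<theta> m \<zeta> (c *s x) i = c *s eigen_component \<theta> m \<zeta> x i" for x y c i
    using linear_component by (auto simp: Vector_Spaces.linear_iff eigen_component_def)
  have if_add: "(if P then u + v else 0) = (if P then u else 0) + (if P then v else 0)"
    and if_scale: "(if P then c *s u else 0) = c *s (if P then u else 0)" for P and u v :: 'v and c
    by simp_all
  show "Vector_Spaces.linear scale scale (contracted_bracket \<theta> m \<zeta> x)"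
    "Vector_Spaces.linear scale scale (\<lambda>x. contracted_bracket \<theta> m \<zeta> x y)"
    by (simp_all only: Vector_Spaces.linear_iff vector_space_axioms contracted_bracket_def lin
      bracket_add_left bracket_add_right bracket_scale_left bracket_scale_right if_add if_scale
      sum.distrib scale_sum_right simp_thms)
qed

text \<open>By bilinearity it suffices to compare the brackets on \<open>E\<close>, whose elements
  are at once homogeneous for \<open>G\<close> and eigenvectors of \<open>\<theta>\<close>; there
  the cutoff of the contraction becomes a condition on degrees.\<close>

lemma contracted_bracket_eq_semidirect_bracket:
  assumes G: "lie_grading G" and \<theta>: "Vector_Spaces.linear scale scale \<theta>"
    and \<zeta>: "primitive_root_of_unity m \<zeta>" and span: "span E = UNIV"
    and E: "\<And>b. b \<in> E \<Longrightarrow> \<exists>j. \<bar>j\<bar> < int m \<and> b \<in> G j \<and> \<theta> b = (\<zeta> powi j) *s b"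
  shows "contracted_bracket \<theta> m \<zeta> = semidirect_bracket (nonneg_part G) (neg_part G)"
proof -
  have m: "m > 0" and \<zeta>m: "\<zeta> ^ m = 1" using \<zeta> by (auto simp: primitive_root_of_unity_def)
  then have \<zeta>0: "\<zeta> \<noteq> 0" by (auto simp: power_0_left)
  \<comment> \<open>The index of the eigenspace that contains degree \<open>j\<close>. For
    \<open>j\<close> strictly between \<open>- m\<close> and \<open>m\<close> it is \<open>j\<close>
    if \<open>j\<close> is nonnegative and \<open>j + m\<close> otherwise.\<close>
  define e where "e j = nat (j mod int m)" for j
  have e_less: "e j < m" for j using m by (simp add: e_def nat_less_iff)
  have e_nonneg: "e j = nat j" if "0 \<le> j" "j < int m" for j
    using that by (simp add: e_def)
  have e_neg: "e j = nat (j + int m)" if "j < 0" "- int m < j" for j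
  proof -
    have "j mod int m = (j + int m) mod int m" by simp
    also have "\<dots> = j + int m" using that by (intro mod_pos_pos_trivial) auto
    finally show ?thesis by (simp add: e_def)
  qed
  have \<zeta>_e: "\<zeta> powi j = \<zeta> ^ e j" for j
  proof -
    have "\<zeta> powi j = \<zeta> powi (int m * (j div int m) + int (e j))" using m by (simp add: e_def)
    also have "\<dots> = (\<zeta> powi int m) powi (j div int m) * \<zeta> ^ e j"
      using \<zeta>0 by (simp only: power_int_add power_int_mult power_int_of_nat simp_thms)
    finally show ?thesis by (simp add: \<zeta>m)
  qed
  let ?V = "\<lambda>i. eigenspace \<theta> (\<zeta> ^ i)"
  have "E \<subseteq> (\<Union>i<m. ?V i)"
    using E e_less by (fastforce simp: eigenspace_def \<zeta>_e)
  then have "span (\<Union>i<m. ?V i) = UNIV" using span span_mono by blast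
  then have V: "direct_decomposition scale {0..<m} ?V"
    by (rule eigenspaces_direct_decomposition[OF \<theta> \<zeta>])
  interpret V: direct_decomposition scale "{0..<m}" ?V by (rule V)
  interpret G: direct_decomposition scale UNIV G
    using G by (rule lie_grading_direct_decomposition)
  interpret PN: complements scale "nonneg_part G" "neg_part G"
    using G by (rule grading_complements)
  interpret NP: complements scale "neg_part G" "nonneg_part G"
    by (rule PN.complements_swap)
  \<comment> \<open>Vectors of \<open>E\<close> have degrees strictly between \<open>- m\<close> and
    \<open>m\<close> and they span, so every other graded piece is zero. Brackets that land there
    vanish.\<close>
  have large: "x = 0" if x: "x \<in> G j" and j: "\<bar>j\<bar> \<ge> int m" for x j
  proof -
    have "component UNIV G x j = 0"
    proof (rule linear_eqI_on_span[OF G.linear_component, of "\<lambda>_. 0", OF _ _ span])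
      fix b assume "b \<in> E"
      then obtain i where "\<bar>i\<bar> < int m" "b \<in> G i" using E by blast
      then show "component UNIV G b j = 0" using j by (subst G.component_summand[of i]) auto
    qed (simp add: Vector_Spaces.linear_iff vector_space_axioms)
    then show ?thesis using x G.component_summand[of j x] by simp
  qed
  have proj: "proj_along (nonneg_part G) (neg_part G) b = (if j \<ge> 0 then b else 0)"
    "proj_along (neg_part G) (nonneg_part G) b = (if j \<ge> 0 then 0 else b)" if "b \<in> G j" for b j
  proof -
    have "b \<in> nonneg_part G" if "j \<ge> 0"
      using \<open>b \<in> G j\<close> that unfolding nonneg_part_def by (intro span_base) auto
    moreover have "b \<in> neg_part G" if "\<not> j \<ge> 0"
      using \<open>b \<in> G j\<close> that unfolding neg_part_def by (intro span_base) auto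
    ultimately show "proj_along (nonneg_part G) (neg_part G) b = (if j \<ge> 0 then b else 0)"
      "proj_along (neg_part G) (nonneg_part G) b = (if j \<ge> 0 then 0 else b)"
      by (auto simp: PN.proj_along_of_mem NP.proj_along_of_mem)
  qed
  have on_E: "contracted_bracket \<theta> m \<zeta> a b = semidirect_bracket (nonneg_part G) (neg_part G) a b"
    if ab: "a \<in> E" "b \<in> E" for a b
  proof -
    obtain i j where i: "\<bar>i\<bar> < int m" "a \<in> G i" "\<theta> a = (\<zeta> powi i) *s a"
      and j: "\<bar>j\<bar> < int m" "b \<in> G j" "\<theta> b = (\<zeta> powi j) *s b"
      using E[OF ab(1)] E[OF ab(2)] by blast
    have "a \<in> ?V (e i)" "b \<in> ?V (e j)" using i(3) j(3) by (simp_all add: eigenspace_def \<zeta>_e)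
    then have comp: "eigen_component \<theta> m \<zeta> a = (\<lambda>k. if k = e i then a else 0)"
      "eigen_component \<theta> m \<zeta> b = (\<lambda>k. if k = e j then b else 0)"
      unfolding eigen_component_def using e_less by (simp_all add: V.component_summand)
    have "contracted_bracket \<theta> m \<zeta> a b =
        (\<Sum>k\<in>{0..<m}. \<Sum>k'\<in>{0..<m}. if k = e i then
          (if k' = e j then (if e i + e j \<le> m - 1 then bracket a b else 0) else 0) else 0)"
      unfolding contracted_bracket_def comp by (intro sum.cong refl) auto
    also have "\<dots> = (\<Sum>k\<in>{0..<m}. if k = e i then
          (\<Sum>k'\<in>{0..<m}. if k' = e j then (if e i + e j \<le> m - 1 then bracket a b else 0) else 0) else 0)"
      by (intro sum.cong refl) auto
    also have "\<dots> = (if e i + e j \<le> m - 1 then bracket a b else 0)"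
      using e_less by simp
    finally have contr: "contracted_bracket \<theta> m \<zeta> a b = (if e i + e j \<le> m - 1 then bracket a b else 0)" .
    have br: "bracket a b \<in> G (i + j)" using bracket_grading[OF G i(2) j(2)] .
    have zero: "bracket a b = 0" if "\<bar>i + j\<bar> \<ge> int m" using large[OF br that] .
    have semi: "semidirect_bracket (nonneg_part G) (neg_part G) a b =
      (if i \<ge> 0 \<and> j \<ge> 0 then bracket a b
       else if i < 0 \<and> j < 0 then 0 else if i + j \<ge> 0 then 0 else bracket a b)"
      unfolding semidirect_bracket_def proj[OF i(2)] proj[OF j(2)]
      using proj(2)[OF br] NP.proj_along_of_mem(2)[of 0] PN.subspaces subspace_0
      by (auto simp: not_le)
    show ?thesis
    \<comment> \<open>Both nonnegative: the cutoff removes only the case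
      \<open>i + j \<ge> m\<close>, where the bracket is 0. Mixed signs: the indices add up to
      \<open>i + j + m\<close>, which is at most \<open>m - 1\<close> exactly when
      \<open>i + j < 0\<close>, that is, when the projection to \<open>neg_part G\<close> keeps the
      bracket. Both negative: the cutoff keeps only \<open>i + j + 2 * m \<le> m - 1\<close>, hence
      \<open>i + j < - m\<close>, where the bracket is 0.\<close>
    proof (cases "i \<ge> 0"; cases "j \<ge> 0")
      assume "i \<ge> 0" "j \<ge> 0"
      then show ?thesis using i(1) j(1) zero m by (auto simp: contr semi e_nonneg)
    next
      assume "i \<ge> 0" "\<not> j \<ge> 0"
      then show ?thesis using i(1) j(1) m by (auto simp: contr semi e_nonneg e_neg)
    next
      assume "\<not> i \<ge> 0" "j \<ge> 0"
      then show ?thesis using i(1) j(1) m by (auto simp: contr semi e_nonneg e_neg)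
    next
      assume "\<not> i \<ge> 0" "\<not> j \<ge> 0"
      then show ?thesis using i(1) j(1) zero m by (auto simp: contr semi e_neg)
    qed
  qed
  have "contracted_bracket \<theta> m \<zeta> x y = semidirect_bracket (nonneg_part G) (neg_part G) x y" for x y
    by (rule bilinear_eqI_on_span[OF linear_contracted_bracket(2,1)[OF V]
        linear_semidirect_bracket(2,1)[OF PN.complements_axioms] on_E span])
  then show ?thesis by blast
qed

end

theorem theorem4p1:
  fixes scale :: "'k::{alg_closed_field, field_char_0} \<Rightarrow> 'v::ab_group_add \<Rightarrow> 'v"
    and br :: "'v \<Rightarrow> 'v \<Rightarrow> 'v"
    and t :: "'v set" and \<alpha> :: "nat \<Rightarrow> 'v \<Rightarrow> 'k" and \<delta> :: "'v \<Rightarrow> 'k"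
    and l m :: nat and p :: "nat \<Rightarrow> nat" and \<zeta> :: 'k
    and \<theta> :: "'v \<Rightarrow> 'v" and G :: "int \<Rightarrow> 'v set"
  assumes "simple_lie_algebra scale br"
    and "lie_algebra.cartan_subalgebra scale br t"
    and "l = vector_space.dim scale t"
    and "lie_algebra.simple_roots scale br t \<alpha> l"
    and "lie_algebra.highest_root scale br t \<alpha> l \<delta>"
    and "kac_labels l p"
    and "m = kac_order \<alpha> l \<delta> p"
    and "primitive_root_of_unity m \<zeta>"
    and "lie_algebra.kac_automorphism scale br t \<alpha> l p \<zeta> \<theta>"
    and "p 0 > 0"
    and "lie_algebra.lie_grading scale br G"
    and "t \<subseteq> G 0"
    and "\<forall>i\<in>{1..l}. lie_algebra.root_space scale br t (\<alpha> i) \<subseteq> G (int (p i))"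
  shows "lie_isomorphic
           scale (lie_algebra.contracted_bracket scale br \<theta> m \<zeta>)
           scale (lie_algebra.semidirect_bracket br
                    (lie_algebra.nonneg_part scale G) (lie_algebra.neg_part scale G))"
proof -
  interpret simple_lie_algebra scale br by fact
  obtain B0 where B0: "finite B0" "span B0 = UNIV" using finite_dim by blast
  have finite_indep: "finite B" if "independent B" for B
    using independent_span_bound[OF B0(1) that] B0(2) by simp
  obtain C where C: "C \<subseteq> t" "independent C" "t \<subseteq> span C"
    using maximal_independent_subset by blast
  let ?R = "t \<union> (\<Union>\<gamma>\<in>roots t. root_space t \<gamma>)"
  have R: "span ?R = UNIV"
    using root_spaces_span[OF assms(2) finite_indep[OF C(2)] C(1,3)] .
  \<comment> \<open>A basis inside \<open>t\<close> and the root spaces, as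
    \<open>root_basis\<close> requires.\<close>
  obtain B where B: "B \<subseteq> ?R" "independent B" "?R \<subseteq> span B"
    using maximal_independent_subset by blast
  have "span B = UNIV" using R span_minimal[OF B(3) subspace_span] by blast
  then interpret root_basis scale br B t \<alpha> l
    using B finite_indep[OF B(2)] assms(2,4) by unfold_locales auto
  have \<theta>: "inner_automorphism \<theta>" "\<And>h. h \<in> t \<Longrightarrow> \<theta> h = h"
    "\<And>\<gamma> x. \<gamma> \<in> roots t \<Longrightarrow> x \<in> root_space t \<gamma> \<Longrightarrow> \<theta> x = scale (\<zeta> powi kac_degree \<alpha> l p \<gamma>) x"
    using assms(9) by (auto simp: kac_automorphism_def)
  have "m > 0" using assms(8) by (simp add: primitive_root_of_unity_def)
  have eq: "contracted_bracket \<theta> m \<zeta> = semidirect_bracket (nonneg_part G) (neg_part G)"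
  proof (rule contracted_bracket_eq_semidirect_bracket[OF assms(11)
        linear_inner_automorphism[OF \<theta>(1)] assms(8) R])
    fix b assume "b \<in> ?R"
    then consider "b \<in> t" | \<gamma> where "\<gamma> \<in> roots t" "b \<in> root_space t \<gamma>" by blast
    then show "\<exists>j. \<bar>j\<bar> < int m \<and> b \<in> G j \<and> \<theta> b = scale (\<zeta> powi j) b"
    proof cases
      case 1
      then show ?thesis using \<theta>(2) assms(12) \<open>m > 0\<close> by (intro exI[of _ 0]) auto
    next
      case 2
      then show ?thesis
        using \<theta>(3) root_space_grading[OF assms(11,12), of p \<gamma>] assms(13)
          kac_degree_bound[OF assms(5), of p \<gamma>] assms(7,10)
        by (intro exI[of _ "kac_degree \<alpha> l p \<gamma>"]) auto
    qed
  qed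
  \<comment> \<open>Through \<open>eq\<close> this also shows that the contracted bracket is a Lie
    bracket, which \<open>lie_isomorphic\<close> includes.\<close>
  have "lie_algebra scale (semidirect_bracket (nonneg_part G) (neg_part G))"
    by (intro lie_algebra_semidirect_bracket grading_complements subalgebra_nonneg_part assms(11))
  moreover have "Vector_Spaces.linear scale scale id"
    by (simp add: Vector_Spaces.linear_iff vector_space_axioms)
  ultimately show ?thesis
    unfolding lie_isomorphic_def eq by (intro conjI exI[of _ id]) auto
qed

end
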